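(* Let $E$ be a uniformly convex Banach space whose norm is Fréchet differentiable and let $\tau$ be a Hausdorff topology on $E$. Let $\{ T(t) : t \geq 0 \}$ be a one-parameter $\tau$-continuous semigroup of nonexpansive mappings on a bounded closed convex subset $C$ of $E$. Fix $\alpha, \beta > 0$ with $\alpha / \beta \notin \mathbb{Q}$, and $\kappa, \lambda > 0$ with $\kappa + \lambda < 1$. Define a sequence $\{ x_n \}$ in $C$ by $x_1 \in C$ and $$ x_{n+1} = \kappa\, T(\alpha) x_n + \lambda\, T(\beta) x_n + (1-\kappa-\lambda) x_n $$ for $n \in \mathbb{N}$. Then $\{ x_n \}$ converges weakly to a common fixed point of $\{ T(t) : t \geq 0 \}$.
   Context: $\mathbb{N}$ is the set of positive integers and $\mathbb{Q}$ the set of rational numbers. A Banach space $E$ is uniformly convex if for each $\varepsilon > 0$ there exists $\delta > 0$ such that $\|x+y\|/2 < 1-\delta$ for all $x,y \in E$ with $\|x\|=\|y\|=1$ and $\|x-y\| \geq \varepsilon$. The norm of $E$ is Fréchet differentiable if for each $x \in E$ with $\|x\|=1$, the limit $\lim_{t \to 0} (\|x+ty\|-\|x\|)/t$ exists and is attained uniformly in $y \in E$ with $\|y\|=1$. Let $C$ be a subset of a Banach space $E$ and let $\tau$ be a Hausdorff topology on $E$ (not necessarily the norm topology). A family $\{T(t) : t \geq 0\}$ of mappings from $C$ into $C$ is called a one-parameter $\tau$-continuous semigroup of nonexpansive mappings on $C$ if: (sg 1) $T(s+t) = T(s) \circ T(t)$ for all $s, t \geq 0$; (sg 2) for each $x \in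 C$, the mapping $t \mapsto T(t)x$ from $[0,\infty)$ into $C$ is continuous with respect to $\tau$; (sg 3) for each $t \geq 0$, $T(t)$ is nonexpansive, i.e., $\|T(t)x - T(t)y\| \leq \|x-y\|$ for all $x,y \in C$. (It is not required that $T(0)$ be the identity mapping.) A common fixed point of $\{T(t) : t \geq 0\}$ is a point $z \in C$ with $T(t)z = z$ for all $t \geq 0$. *)

theory Defs
  imports "HOL-Analysis.Analysis"
begin

definition uniformly_convex :: "'a::real_normed_vector itself \<Rightarrow> bool" where
  "uniformly_convex _ \<longleftrightarrow>
     (\<forall>\<epsilon>>0. \<exists>\<delta>>0. \<forall>x y::'a. norm x = 1 \<and> norm y = 1 \<and> norm (x - y) \<ge> \<epsilon> \<longrightarrow>
        norm (x + y) / 2 < 1 - \<delta>)"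

(* The uniformity is in the direction y only, for each fixed x; l is the limit function. *)
definition frechet_differentiable_norm :: "'a::real_normed_vector itself \<Rightarrow> bool" where
  "frechet_differentiable_norm _ \<longleftrightarrow>
     (\<forall>x::'a. norm x = 1 \<longrightarrow>
        (\<exists>l::'a \<Rightarrow> real. uniform_limit {y. norm y = 1}
           (\<lambda>t y. (norm (x + t *\<^sub>R y) - norm x) / t) l (at 0)))"

(* Only the values T t x with t \<ge> 0 and x \<in> C matter. T 0 need not be the identity. *)
definition nonexpansive_semigroup ::
    "'a::real_normed_vector topology \<Rightarrow> 'a set \<Rightarrow> (real \<Rightarrow> 'a \<Rightarrow> 'a) \<Rightarrow> bool" where
  "nonexpansive_semigroup \<tau> C T \<longleftrightarrow>
     (\<forall>t\<ge>0. \<forall>x\<in>C. T t x \<in> C) \<and>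
     (\<forall>s\<ge>0. \<forall>t\<ge>0. \<forall>x\<in>C. T (s + t) x = T s (T t x)) \<and>
     (\<forall>x\<in>C. continuous_map (top_of_set {0..}) (subtopology \<tau> C) (\<lambda>t. T t x)) \<and>
     (\<forall>t\<ge>0. \<forall>x\<in>C. \<forall>y\<in>C. norm (T t x - T t y) \<le> norm (x - y))"

definition common_fixed_point :: "'a set \<Rightarrow> (real \<Rightarrow> 'a \<Rightarrow> 'a) \<Rightarrow> 'a \<Rightarrow> bool" where
  "common_fixed_point C T z \<longleftrightarrow> z \<in> C \<and> (\<forall>t\<ge>0. T t z = z)"

definition weakly_converges :: "(nat \<Rightarrow> 'a::real_normed_vector) \<Rightarrow> 'a \<Rightarrow> bool" where
  "weakly_converges x z \<longleftrightarrow>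
     (\<forall>f::'a \<Rightarrow> real. bounded_linear f \<longrightarrow> (\<lambda>n. f (x n)) \<longlonglongrightarrow> f z)"

end

theory Submission
  imports Defs
begin

text \<open>
  The map \<open>U = \<kappa> T(\<alpha>) + \<mu> T(\<beta>) + (1 - \<kappa> - \<mu>) I\<close> is nonexpansive. The commuting maps
  \<open>T(\<alpha>)\<close> and \<open>T(\<beta>)\<close> have a common fixed point, so uniform convexity makes
  \<open>x n - T(\<alpha>) (x n)\<close> and \<open>x n - T(\<beta>) (x n)\<close> tend to \<open>0\<close>; applied to constant sequences
  this shows that every fixed point of \<open>U\<close> is fixed by both maps. A point \<open>z\<close> fixed by
  \<open>T(\<alpha>)\<close> and \<open>T(\<beta>)\<close> has an orbit \<open>t \<mapsto> T(t) z\<close> with the incommensurable periods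
  \<open>\<alpha>\<close> and \<open>\<beta>\<close>, hence a constant one.

  Weak compactness is replaced by the fact that decreasing bounded closed convex sets in a
  uniformly convex space intersect: every subsequence of \<open>x\<close> has a further subsequence whose
  closed convex tail hulls share a fixed point of \<open>U\<close>. By the differentiability of the norm there
  is only one fixed point of \<open>U\<close> in all closed convex tail hulls of \<open>x\<close>, and this point is the
  weak limit.
\<close>

section \<open>Uniform convexity and almost affine maps\<close>

text \<open>If the midpoint of two vectors of the unit ball has norm close to 1, then so do both
  vectors. Replacing them by \<open>sgn\<close> costs little, and the definition applies to the
  normalised pair at distance \<epsilon>/2.\<close>

lemma uniformly_convex_unit_ball:
  assumes uc: "uniformly_convex TYPE('a::real_normed_vector)" and "\<epsilon> > 0"
  obtains \<delta> where "\<delta> > 0"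
    "\<And>u v::'a. \<lbrakk>norm u \<le> 1; norm v \<le> 1; norm (u - v) \<ge> \<epsilon>\<rbrakk> \<Longrightarrow> norm (u + v) / 2 \<le> 1 - \<delta>"
proof -
  obtain d where d: "d > 0"
    "\<And>x y::'a. \<lbrakk>norm x = 1; norm y = 1; norm (x - y) \<ge> \<epsilon>/2\<rbrakk> \<Longrightarrow> norm (x + y) / 2 < 1 - d"
    using uc \<open>\<epsilon> > 0\<close> unfolding uniformly_convex_def by (metis half_gt_zero)
  \<comment> \<open>Normalising moves each vector by at most \<open>2*\<delta>\<close>: \<epsilon>/8
    keeps the normalised vectors \<epsilon>/2 apart, d/4 leaves a contradiction with the midpoint
    bound \<open>1 - d\<close>, and 1/4 keeps \<open>norm w\<close> away from 0.\<close>
  define \<delta> where "\<delta> = min (\<epsilon>/8) (min (d/4) (1/4))"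
  have \<delta>: "\<delta> > 0" "\<delta> \<le> \<epsilon>/8" "\<delta> \<le> d/4" "\<delta> \<le> 1/4"
    using d \<open>\<epsilon> > 0\<close> by (auto simp: \<delta>_def)
  have "norm (u + v) / 2 \<le> 1 - \<delta>" if uv: "norm u \<le> 1" "norm v \<le> 1" "norm (u - v) \<ge> \<epsilon>" for u v :: 'a
  proof (rule ccontr)
    assume "\<not> ?thesis"
    then have big: "norm (u + v) > 2 - 2*\<delta>" by simp
    have "norm (u + v) \<le> norm u + norm v" by (rule norm_triangle_ineq)
    then have nu: "norm u > 1 - 2*\<delta>" and nv: "norm v > 1 - 2*\<delta>"
      using big uv by linarith+
    have near: "norm (sgn w) = 1 \<and> norm (sgn w - w) \<le> 2*\<delta>"
      if w: "norm w > 1 - 2*\<delta>" "norm w \<le> 1" for w :: 'a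
    proof -
      have "w \<noteq> 0" using w \<delta> by auto
      have "sgn w - w = (1 - norm w) *\<^sub>R sgn w"
        using \<open>w \<noteq> 0\<close> by (simp add: sgn_div_norm algebra_simps)
      then show ?thesis
        using w \<open>w \<noteq> 0\<close> by (simp add: norm_sgn)
    qed
    have u: "norm (sgn u) = 1" "norm (sgn u - u) \<le> 2*\<delta>"
      and v: "norm (sgn v) = 1" "norm (sgn v - v) \<le> 2*\<delta>"
      using near nu nv uv by blast+
    have "norm (u - v) \<le> norm (sgn u - sgn v) + (norm (sgn u - u) + norm (sgn v - v))"
      using norm_triangle_ineq4[of "sgn u - sgn v" "(sgn u - u) - (sgn v - v)"]
        norm_triangle_ineq4[of "sgn u - u" "sgn v - v"] by simp
    then have "norm (sgn u - sgn v) \<ge> \<epsilon>/2"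
      using u v uv \<delta> by linarith
    then have "norm (sgn u + sgn v) / 2 < 1 - d"
      using d u v by blast
    moreover have "norm (u + v) \<le> norm (sgn u + sgn v) + (norm (sgn u - u) + norm (sgn v - v))"
      using norm_triangle_ineq4[of "sgn u + sgn v" "(sgn u - u) + (sgn v - v)"]
        norm_triangle_ineq[of "sgn u - u" "sgn v - v"] by (simp add: add.commute)
    ultimately show False
      using big u v \<delta> d by linarith
  qed
  then show ?thesis using \<delta> that by blast
qed

text \<open>Rescaling by \<open>r\<close> reduces to the unit ball. The gap is uniform in
  \<open>r\<close> because two points at distance \<epsilon> force
  \<open>r \<ge> \<epsilon>/2\<close>.\<close>

lemma uniformly_convex_ball:
  assumes uc: "uniformly_convex TYPE('a::real_normed_vector)" and "\<epsilon> > 0" "R > 0"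
  obtains \<delta> where "\<delta> > 0"
    "\<And>(u::'a) v r. \<lbrakk>r \<le> R; norm u \<le> r; norm v \<le> r; norm (u - v) \<ge> \<epsilon>\<rbrakk> \<Longrightarrow> norm (u + v) / 2 \<le> r - \<delta>"
proof -
  obtain d where d: "d > 0"
    "\<And>u v::'a. \<lbrakk>norm u \<le> 1; norm v \<le> 1; norm (u - v) \<ge> \<epsilon>/R\<rbrakk> \<Longrightarrow> norm (u + v) / 2 \<le> 1 - d"
    using uniformly_convex_unit_ball[OF uc, of "\<epsilon>/R"] assms by auto
  have "norm (u + v) / 2 \<le> r - d * \<epsilon> / 2"
    if uv: "r \<le> R" "norm u \<le> r" "norm v \<le> r" "norm (u - v) \<ge> \<epsilon>" for u v :: 'a and r
  proof -
    have "norm (u - v) \<le> norm u + norm v" by (rule norm_triangle_ineq4)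
    then have r: "r \<ge> \<epsilon>/2" using uv by linarith
    then have "r > 0" using \<open>\<epsilon> > 0\<close> by linarith
    have "norm (u /\<^sub>R r) \<le> 1" "norm (v /\<^sub>R r) \<le> 1"
      using uv \<open>r > 0\<close> by (auto simp: field_simps)
    moreover have "norm (u /\<^sub>R r - v /\<^sub>R r) = norm (u - v) / r"
      using \<open>r > 0\<close> by (simp add: divide_inverse_commute flip: scaleR_diff_right)
    moreover have "\<epsilon> / R \<le> norm (u - v) / r"
      using uv \<open>r > 0\<close> \<open>\<epsilon> > 0\<close> by (intro frac_le) auto
    ultimately have "norm (u /\<^sub>R r + v /\<^sub>R r) / 2 \<le> 1 - d"
      using d by simp
    moreover have "norm (u /\<^sub>R r + v /\<^sub>R r) = norm (u + v) / r"
      using \<open>r > 0\<close> by (simp add: divide_inverse_commute flip: scaleR_add_right)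
    ultimately have "norm (u + v) / r / 2 \<le> 1 - d" by simp
    then have "norm (u + v) / 2 \<le> r - r * d"
      using \<open>r > 0\<close> by (simp add: field_simps)
    moreover have "r * d \<ge> \<epsilon>/2 * d"
      using r d by (intro mult_right_mono) auto
    ultimately show ?thesis by (simp add: mult.commute)
  qed
  then show ?thesis
    using that[of "d * \<epsilon> / 2"] d \<open>\<epsilon> > 0\<close> by auto
qed

text \<open>For \<open>t \<le> 1/2\<close> the combination is
  \<open>(1 - 2*t) *\<^sub>R u + t *\<^sub>R (u + v)\<close>, so a midpoint deficit \<open>d\<close>
  lowers its norm by \<open>2*t*d\<close>; exchanging \<open>u\<close> and \<open>v\<close> covers
  the other half. The factor \<open>t * (1 - t)\<close> absorbs the endpoints, where the norm of the
  combination says nothing about \<open>u - v\<close>.\<close>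

lemma uniformly_convex_weighted:
  assumes uc: "uniformly_convex TYPE('a::real_normed_vector)" and "\<epsilon> > 0"
  obtains \<delta> where "\<delta> > 0"
    "\<And>(u::'a) v t. \<lbrakk>norm u \<le> 1; norm v \<le> 1; 0 \<le> t; t \<le> 1; norm ((1 - t) *\<^sub>R u + t *\<^sub>R v) > 1 - \<delta>\<rbrakk>
       \<Longrightarrow> t * (1 - t) * norm (u - v) < \<epsilon>"
proof -
  obtain d where d: "d > 0"
    "\<And>u v::'a. \<lbrakk>norm u \<le> 1; norm v \<le> 1; norm (u - v) \<ge> \<epsilon>\<rbrakk> \<Longrightarrow> norm (u + v) / 2 \<le> 1 - d"
    using uniformly_convex_unit_ball[OF uc, of "\<epsilon>"] assms by auto
  have half: "norm ((1 - t) *\<^sub>R u + t *\<^sub>R v) \<le> 1 - \<epsilon> * d"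
    if uv: "norm u \<le> 1" "norm v \<le> 1" "0 \<le> t" "t \<le> 1/2" and ge: "t * (1 - t) * norm (u - v) \<ge> \<epsilon>"
    for u v :: 'a and t
  proof -
    have n2: "norm (u - v) \<le> 2"
      using norm_triangle_ineq4[of u v] uv by linarith
    have "t * (1 - t) * norm (u - v) \<le> 1 * norm (u - v)"
      using uv by (intro mult_right_mono mult_le_one) auto
    then have "norm (u - v) \<ge> \<epsilon>" using ge by simp
    then have mid: "norm (u + v) / 2 \<le> 1 - d" using d uv by blast
    have "t * (1 - t) * norm (u - v) \<le> t * 1 * 2"
      using uv n2 by (intro mult_mono) auto
    then have t: "2 * t \<ge> \<epsilon>" using ge by simp
    have "(1 - t) *\<^sub>R u + t *\<^sub>R v = (1 - 2*t) *\<^sub>R u + t *\<^sub>R (u + v)"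
      by (simp add: algebra_simps flip: scaleR_2)
    then have "norm ((1 - t) *\<^sub>R u + t *\<^sub>R v) \<le> (1 - 2*t) * norm u + t * norm (u + v)"
      using uv norm_triangle_ineq[of "(1 - 2*t) *\<^sub>R u" "t *\<^sub>R (u + v)"] by simp
    also have "\<dots> \<le> (1 - 2*t) * 1 + t * (2 * (1 - d))"
      using uv mid by (intro add_mono mult_left_mono) auto
    also have "\<dots> = 1 - (2*t) * d" by (simp add: algebra_simps)
    also have "\<dots> \<le> 1 - \<epsilon> * d" using t d by simp
    finally show ?thesis .
  qed
  have "t * (1 - t) * norm (u - v) < \<epsilon>"
    if uv: "norm u \<le> 1" "norm v \<le> 1" "0 \<le> t" "t \<le> 1"
      and big: "norm ((1 - t) *\<^sub>R u + t *\<^sub>R v) > 1 - \<epsilon> * d" for u v :: 'a and t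
  proof (cases "t \<le> 1/2")
    case True
    then show ?thesis using half[of u v t] uv big by linarith
  next
    case False
    then show ?thesis
      using half[of v u "1 - t"] uv big by (fastforce simp: norm_minus_commute mult.commute add.commute)
  qed
  then show ?thesis
    using that[of "\<epsilon> * d"] d \<open>\<epsilon> > 0\<close> by auto
qed

text \<open>Bruck's inequality: with \<open>c\<close> the image of the point \<open>t x + (1 - t) y\<close>, the vectors
  \<open>S x - c\<close> and \<open>c - S y\<close> have norms at most \<open>(1 - t) d\<close> and \<open>t d\<close>, where \<open>d = norm (x - y)\<close>,
  while their sum has norm almost \<open>d\<close>. Uniform convexity forces them to be nearly parallel.\<close>

lemma nonexpansive_almost_affine:
  fixes C :: "'a::real_normed_vector set"
  assumes uc: "uniformly_convex TYPE('a)" and "bounded C" "convex C" "\<epsilon> > 0"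
  obtains \<delta> where "\<delta> > 0"
    "\<And>(S::'a \<Rightarrow> 'a) x y t. \<lbrakk>1-lipschitz_on C S; x \<in> C; y \<in> C; 0 \<le> t; t \<le> 1;
        norm (x - y) - norm (S x - S y) < \<delta>\<rbrakk>
       \<Longrightarrow> norm (S (t *\<^sub>R x + (1 - t) *\<^sub>R y) - (t *\<^sub>R S x + (1 - t) *\<^sub>R S y)) < (\<epsilon>::real)"
proof -
  obtain B where B: "B > 0" "\<And>x. x \<in> C \<Longrightarrow> norm x \<le> B"
    using \<open>bounded C\<close> bounded_pos by blast
  obtain \<eta> where \<eta>: "\<eta> > 0"
    "\<And>(u::'a) v t. \<lbrakk>norm u \<le> 1; norm v \<le> 1; 0 \<le> t; t \<le> 1; norm ((1 - t) *\<^sub>R u + t *\<^sub>R v) > 1 - \<eta>\<rbrakk>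
       \<Longrightarrow> t * (1 - t) * norm (u - v) < \<epsilon> / (2*B)"
    using uniformly_convex_weighted[OF uc, of "\<epsilon>/(2*B)"] B \<open>\<epsilon> > 0\<close> by auto
  have "norm (S (t *\<^sub>R x + (1 - t) *\<^sub>R y) - (t *\<^sub>R S x + (1 - t) *\<^sub>R S y)) < \<epsilon>"
    if S: "1-lipschitz_on C S" and xy: "x \<in> C" "y \<in> C" and t: "0 \<le> t" "t \<le> 1"
      and diff: "norm (x - y) - norm (S x - S y) < \<eta> * (\<epsilon>/2)" for S :: "'a \<Rightarrow> 'a" and x y t
  proof -
    define d where "d = norm (x - y)"
    define m where "m = t *\<^sub>R x + (1 - t) *\<^sub>R y"
    define u where "u = S x - S m"
    define v where "v = S m - S y"
    have mC: "m \<in> C"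
      unfolding m_def using \<open>convex C\<close> xy t by (intro convexD) auto
    have "x - m = (1 - t) *\<^sub>R (x - y)" "m - y = t *\<^sub>R (x - y)"
      by (simp_all add: m_def algebra_simps)
    then have nu: "norm u \<le> (1 - t) * d" and nv: "norm v \<le> t * d"
      unfolding u_def v_def d_def
      using lipschitz_on_normD[OF S xy(1) mC] lipschitz_on_normD[OF S mC xy(2)] t by auto
    have eq: "S m - (t *\<^sub>R S x + (1 - t) *\<^sub>R S y) = (1 - t) *\<^sub>R v - t *\<^sub>R u"
      by (simp add: u_def v_def algebra_simps)
    have small: "norm ((1 - t) *\<^sub>R v - t *\<^sub>R u) < \<epsilon>"
    \<comment> \<open>Short segments satisfy the estimate trivially. On long ones
      \<open>d \<ge> \<epsilon>\<close> turns the absolute defect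
      \<open>\<eta> * (\<epsilon>/2)\<close> into a defect of at most \<eta> relative to
      \<open>d\<close>.\<close>
    proof (cases "d < \<epsilon>")
      case True
      have "norm ((1 - t) *\<^sub>R v - t *\<^sub>R u) \<le> (1 - t) * norm v + t * norm u"
        using norm_triangle_ineq4[of "(1 - t) *\<^sub>R v" "t *\<^sub>R u"] t by simp
      also have "\<dots> \<le> (1 - t) * (t * d) + t * ((1 - t) * d)"
        using nu nv t by (intro add_mono mult_left_mono) auto
      also have "\<dots> = 2 * (t * (1 - t)) * d" by (simp add: algebra_simps)
      also have "\<dots> \<le> 1 * d"
      proof (rule mult_right_mono)
        have "0 \<le> (2*t - 1)^2" by simp
        then show "2 * (t * (1 - t)) \<le> 1" by (simp add: power2_eq_square algebra_simps)
      qed (simp add: d_def)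
      finally show ?thesis using True by simp
    next
      case False
      then have "d > 0" using \<open>\<epsilon> > 0\<close> by linarith
      have d2: "d \<le> 2*B"
        using norm_triangle_ineq4[of x y] B(2)[OF xy(1)] B(2)[OF xy(2)] by (simp add: d_def)
      define u' where "u' = u /\<^sub>R ((1 - t) * d)"
      define v' where "v' = v /\<^sub>R (t * d)"
      \<comment> \<open>For \<open>t = 1\<close> the divisor is 0 and \<open>u'\<close> becomes 0,
        but then \<open>nu\<close> forces \<open>u = 0\<close>. The same happens to \<open>v\<close>
        for \<open>t = 0\<close>.\<close>
      have u: "u = ((1 - t) * d) *\<^sub>R u'"
        using nu \<open>d > 0\<close> by (cases "t = 1") (auto simp: u'_def simp flip: inverse_mult_distrib)
      have v: "v = (t * d) *\<^sub>R v'"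
        using nv \<open>d > 0\<close> by (cases "t = 0") (auto simp: v'_def simp flip: inverse_mult_distrib)
      have n1: "norm u' \<le> 1" "norm v' \<le> 1"
        using nu nv t \<open>d > 0\<close>
        by (auto simp: u'_def v'_def abs_mult divide_le_eq_1 simp flip: divide_inverse_commute inverse_mult_distrib)
      have "norm (u + v) > d - \<eta> * (\<epsilon>/2)"
        using diff by (simp add: u_def v_def d_def)
      moreover have "\<eta> * (\<epsilon>/2) \<le> \<eta> * d"
        using False \<eta> \<open>\<epsilon> > 0\<close> by (intro mult_left_mono) auto
      moreover have "u + v = d *\<^sub>R ((1 - t) *\<^sub>R u' + t *\<^sub>R v')"
        by (simp add: u v algebra_simps)
      then have "norm (u + v) = d * norm ((1 - t) *\<^sub>R u' + t *\<^sub>R v')"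
        using \<open>d > 0\<close> by simp
      ultimately have "d * norm ((1 - t) *\<^sub>R u' + t *\<^sub>R v') > d * (1 - \<eta>)"
        by (simp add: right_diff_distrib mult.commute)
      then have "norm ((1 - t) *\<^sub>R u' + t *\<^sub>R v') > 1 - \<eta>"
        using \<open>d > 0\<close> by simp
      then have *: "t * (1 - t) * norm (u' - v') < \<epsilon> / (2*B)"
        using \<eta> n1 t by blast
      have "(1 - t) *\<^sub>R v - t *\<^sub>R u = (d * (t * (1 - t))) *\<^sub>R (v' - u')"
        by (simp add: u v algebra_simps)
      then have "norm ((1 - t) *\<^sub>R v - t *\<^sub>R u) = d * (t * (1 - t) * norm (u' - v'))"
        using \<open>d > 0\<close> t by (simp add: norm_minus_commute)
      also have "\<dots> \<le> (2*B) * (t * (1 - t) * norm (u' - v'))"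
        using d2 t by (intro mult_right_mono) auto
      also have "\<dots> < \<epsilon>" using * B by (simp add: field_simps)
      finally show ?thesis .
    qed
    then show ?thesis using eq by (simp add: m_def)
  qed
  then show ?thesis
    using that[of "\<eta> * (\<epsilon>/2)"] \<eta> \<open>\<epsilon> > 0\<close> by simp
qed

text \<open>Two almost fixed points keep their distance under \<open>S\<close> up to
  \<open>2*\<delta>\<close>, so \<open>S\<close> is almost affine on the segment between
  them.\<close>

lemma almost_fixed_convex_combination:
  fixes C :: "'a::real_normed_vector set"
  assumes uc: "uniformly_convex TYPE('a)" and "bounded C" "convex C" "\<epsilon> > 0"
  obtains \<delta> where "0 < \<delta>" "\<delta> \<le> \<epsilon>"
    "\<And>(S::'a \<Rightarrow> 'a) x y t. \<lbrakk>1-lipschitz_on C S; x \<in> C; y \<in> C; 0 \<le> t; t \<le> 1;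
        norm (x - S x) \<le> \<delta>; norm (y - S y) \<le> \<delta>\<rbrakk>
       \<Longrightarrow> norm (t *\<^sub>R x + (1 - t) *\<^sub>R y - S (t *\<^sub>R x + (1 - t) *\<^sub>R y)) \<le> \<epsilon>"
proof -
  obtain d where d: "d > 0"
    "\<And>(S::'a \<Rightarrow> 'a) x y t. \<lbrakk>1-lipschitz_on C S; x \<in> C; y \<in> C; 0 \<le> t; t \<le> 1;
        norm (x - y) - norm (S x - S y) < d\<rbrakk>
       \<Longrightarrow> norm (S (t *\<^sub>R x + (1 - t) *\<^sub>R y) - (t *\<^sub>R S x + (1 - t) *\<^sub>R S y)) < \<epsilon>/2"
    using nonexpansive_almost_affine[OF uc \<open>bounded C\<close> \<open>convex C\<close>, of "\<epsilon>/2"] \<open>\<epsilon> > 0\<close> by auto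
  define \<delta> where "\<delta> = min (d/4) (\<epsilon>/2)"
  have \<delta>: "\<delta> > 0" "\<delta> \<le> d/4" "\<delta> \<le> \<epsilon>/2" using d \<open>\<epsilon> > 0\<close> by (auto simp: \<delta>_def)
  have "norm (t *\<^sub>R x + (1 - t) *\<^sub>R y - S (t *\<^sub>R x + (1 - t) *\<^sub>R y)) \<le> \<epsilon>"
    if S: "1-lipschitz_on C S" and xy: "x \<in> C" "y \<in> C" and t: "0 \<le> t" "t \<le> 1"
      and x: "norm (x - S x) \<le> \<delta>" and y: "norm (y - S y) \<le> \<delta>" for S :: "'a \<Rightarrow> 'a" and x y t
  proof -
    define m where "m = t *\<^sub>R x + (1 - t) *\<^sub>R y"
    have "norm (x - y) \<le> norm (S x - S y) + (norm (x - S x) + norm (y - S y))"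
      using norm_triangle_ineq[of "S x - S y" "(x - S x) - (y - S y)"]
        norm_triangle_ineq4[of "x - S x" "y - S y"] by simp
    then have "norm (S m - (t *\<^sub>R S x + (1 - t) *\<^sub>R S y)) < \<epsilon>/2"
      unfolding m_def using d S xy t x y \<delta> by simp
    moreover have "norm (t *\<^sub>R (x - S x) + (1 - t) *\<^sub>R (y - S y)) \<le> \<delta>"
      by (rule norm_triangle_le) (use t x y in \<open>auto intro!: convex_bound_le\<close>)
    moreover have "norm (m - S m) \<le> norm (t *\<^sub>R (x - S x) + (1 - t) *\<^sub>R (y - S y))
        + norm (S m - (t *\<^sub>R S x + (1 - t) *\<^sub>R S y))"
    proof -
      have "m - S m = t *\<^sub>R (x - S x) + (1 - t) *\<^sub>R (y - S y) - (S m - (t *\<^sub>R S x + (1 - t) *\<^sub>R S y))"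
        by (simp add: m_def algebra_simps)
      then show ?thesis by (simp only: norm_triangle_ineq4)
    qed
    ultimately show ?thesis
      unfolding m_def[symmetric] using \<delta> by linarith
  qed
  then show ?thesis using that[of \<delta>] \<delta> \<open>\<epsilon> > 0\<close> by simp
qed

section \<open>Fixed points of nonexpansive maps\<close>

text \<open>Choose points of almost minimal norm in the sets. Midpoints of two late points stay in
  an early set by convexity, so their norms cannot drop; uniform convexity then makes the sequence
  Cauchy, and its limit lies in every set.\<close>

lemma uniformly_convex_nested_Inter:
  fixes K :: "nat \<Rightarrow> 'a::banach set"
  assumes uc: "uniformly_convex TYPE('a)"
    and K: "\<And>n. closed (K n)" "\<And>n. convex (K n)" "\<And>n. K n \<noteq> {}"
    and "bounded (K 0)" and dec: "\<And>n. K (Suc n) \<subseteq> K n"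
  shows "(\<Inter>n. K n) \<noteq> {}"
proof -
  have anti: "K n \<subseteq> K m" if "m \<le> n" for m n
    using that dec by (rule lift_Suc_antimono_le[rotated])
  obtain B where B: "B > 0" "\<And>x. x \<in> K 0 \<Longrightarrow> norm x \<le> B"
    using \<open>bounded (K 0)\<close> bounded_pos by blast
  define d where "d n = Inf (norm ` K n)" for n
  have bdd: "bdd_below (norm ` K n)" for n by (rule bdd_belowI[of _ 0]) auto
  have d_le: "d n \<le> norm x" if "x \<in> K n" for x n
    unfolding d_def using that bdd by (intro cInf_lower) auto
  have "\<exists>x\<in>K n. norm x < d n + 1 / Suc n" for n
    using cInf_lessD[of "norm ` K n" "d n + 1 / Suc n"] K(3)[of n] by (auto simp: d_def)
  then obtain y where y: "\<And>n. y n \<in> K n" "\<And>n. norm (y n) < d n + 1 / Suc n" by metis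
  have "incseq d"
    unfolding d_def using K(3) bdd dec by (intro incseq_SucI cInf_superset_mono image_mono) auto
  moreover have dB: "d n \<le> B" for n
    using d_le[OF y(1)] B(2) anti[of 0 n] y(1)[of n] by (meson le0 order_trans subsetD)
  ultimately obtain D where D: "d \<longlonglongrightarrow> D" "\<And>n. d n \<le> D"
    by (metis incseq_convergent)
  have DB: "D \<le> B" using LIMSEQ_le_const2[OF D(1)] dB by blast
  have "Cauchy y"
  proof (rule metric_CauchyI)
    fix \<epsilon> :: real assume "\<epsilon> > 0"
    obtain \<delta> where \<delta>: "\<delta> > 0"
      "\<And>(u::'a) v r. \<lbrakk>r \<le> B + 1; norm u \<le> r; norm v \<le> r; norm (u - v) \<ge> \<epsilon>\<rbrakk> \<Longrightarrow> norm (u + v) / 2 \<le> r - \<delta>"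
      using uniformly_convex_ball[OF uc \<open>\<epsilon> > 0\<close>, of "B + 1"] B by auto
    \<comment> \<open>Two errors of \<delta>/2 suffice: a midpoint of distant points would have norm
      at most \<open>D + 1 / Suc N - \<delta>\<close>, which is less than
      \<open>D - \<delta>/2\<close> and hence less than \<open>d N\<close>.\<close>
    have "eventually (\<lambda>n. d n > D - \<delta>/2) sequentially"
      using D(1) \<delta> by (intro order_tendstoD) auto
    moreover have "eventually (\<lambda>n. 1 / Suc n < \<delta>/2) sequentially"
      using \<delta> by (intro order_tendstoD[OF lim_1_over_n[THEN LIMSEQ_Suc]]) auto
    ultimately obtain N where N: "d N > D - \<delta>/2" "1 / Suc N < \<delta>/2"
      by (metis (mono_tags, lifting) eventually_conj eventually_sequentially le_refl)
    have bound: "norm (y n) \<le> D + 1 / Suc N" if "n \<ge> N" for n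
    proof -
      have "1 / real (Suc n) \<le> 1 / real (Suc N)" using that by (intro divide_left_mono) auto
      then show ?thesis using y(2)[of n] D(2)[of n] by linarith
    qed
    have "dist (y m) (y n) < \<epsilon>" if "m \<ge> N" "n \<ge> N" for m n
    proof (rule ccontr)
      assume "\<not> ?thesis"
      then have far: "norm (y m - y n) \<ge> \<epsilon>" by (simp add: dist_norm)
      have "D + 1 / Suc N \<le> B + 1" using DB by (intro add_mono) auto
      then have "norm (y m + y n) / 2 \<le> D + 1 / Suc N - \<delta>"
        using \<delta>(2) bound far that by blast
      moreover have "(1/2) *\<^sub>R y m + (1/2) *\<^sub>R y n \<in> K N"
        using y(1) anti that K(2) by (intro convexD) (auto dest: subsetD)
      then have "d N \<le> norm ((1/2) *\<^sub>R y m + (1/2) *\<^sub>R y n)" by (rule d_le)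
      then have "d N \<le> norm (y m + y n) / 2" by (simp flip: scaleR_add_right)
      ultimately show False using N by linarith
    qed
    then show "\<exists>M. \<forall>m\<ge>M. \<forall>n\<ge>M. dist (y m) (y n) < \<epsilon>" by blast
  qed
  then obtain z where z: "y \<longlonglongrightarrow> z" using Cauchy_convergent_iff convergent_def by blast
  have "z \<in> K n" for n
  proof (rule closed_sequentially[OF K(1)])
    show "(\<lambda>k. y (k + n)) \<longlonglongrightarrow> z" using z by (rule LIMSEQ_ignore_initial_segment)
    show "y (k + n) \<in> K n" for k using y anti by (meson le_add2 subsetD)
  qed
  then show ?thesis by blast
qed

text \<open>Almost fixed points of a nonexpansive map are stable under convex combinations of two points
  only with a loss of accuracy. The subsequence is chosen so fast that the \<open>k\<close>-th term absorbs the
  loss caused by adding it to a convex combination of later terms.\<close>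

lemma nonexpansive_demiclosed:
  fixes C :: "'a::banach set"
  assumes uc: "uniformly_convex TYPE('a)" and C: "bounded C" "closed C" "convex C"
    and S: "1-lipschitz_on C S" and y: "\<And>k. y k \<in> C" "(\<lambda>k. y k - S (y k)) \<longlonglongrightarrow> 0"
  obtains r p where "strict_mono (r :: nat \<Rightarrow> nat)" "p \<in> C" "S p = p"
    "\<And>n. p \<in> closure (convex hull ((\<lambda>k. y (r k)) ` {n..}))"
proof -
  define F where "F \<delta> = {w \<in> C. norm (w - S w) \<le> \<delta>}" for \<delta>
  have F_mono: "F \<delta> \<subseteq> F \<epsilon>" if "\<delta> \<le> \<epsilon>" for \<delta> \<epsilon> using that by (auto simp: F_def)
  \<comment> \<open>Packed into one predicate so that \<delta> can be chosen as a function
    \<open>g\<close> of \<epsilon>.\<close>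
  define good where "good \<delta> \<epsilon> \<longleftrightarrow> 0 < \<delta> \<and> \<delta> \<le> \<epsilon> \<and> (\<forall>a\<in>F \<delta>. \<forall>b\<in>F \<delta>. \<forall>u v.
      0 \<le> u \<longrightarrow> 0 \<le> v \<longrightarrow> u + v = 1 \<longrightarrow> u *\<^sub>R a + v *\<^sub>R b \<in> F \<epsilon>)" for \<delta> \<epsilon> :: real
  have "\<exists>\<delta>. good \<delta> \<epsilon>"
    if eps: "\<epsilon> > 0" for \<epsilon> :: real
  proof -
    obtain \<delta> where \<delta>: "0 < \<delta>" "\<delta> \<le> \<epsilon>"
      "\<And>(S::'a \<Rightarrow> 'a) x y t. \<lbrakk>1-lipschitz_on C S; x \<in> C; y \<in> C; 0 \<le> t; t \<le> 1;
          norm (x - S x) \<le> \<delta>; norm (y - S y) \<le> \<delta>\<rbrakk>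
         \<Longrightarrow> norm (t *\<^sub>R x + (1 - t) *\<^sub>R y - S (t *\<^sub>R x + (1 - t) *\<^sub>R y)) \<le> \<epsilon>"
      using almost_fixed_convex_combination[OF uc C(1,3) eps] by blast
    have "u *\<^sub>R a + v *\<^sub>R b \<in> F \<epsilon>" if "a \<in> F \<delta>" "b \<in> F \<delta>" "0 \<le> u" "0 \<le> v" "u + v = 1" for a b u v
    proof -
      have v: "v = 1 - u" using that by simp
      show ?thesis
        using \<delta>(3)[OF S, of a b u] that(1-4) convexD[OF C(3), of a b u v] by (simp add: F_def v)
    qed
    then have "good \<delta> \<epsilon>" using \<delta>(1,2) unfolding good_def by blast
    then show ?thesis ..
  qed
  then obtain g where "\<And>\<epsilon>. \<epsilon> > 0 \<Longrightarrow> good (g \<epsilon>) \<epsilon>" by metis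
  then have g: "\<And>\<epsilon>. \<epsilon> > 0 \<Longrightarrow> g \<epsilon> > 0" "\<And>\<epsilon>. \<epsilon> > 0 \<Longrightarrow> g \<epsilon> \<le> \<epsilon>"
    "\<And>\<epsilon> a b u v. \<lbrakk>\<epsilon> > 0; a \<in> F (g \<epsilon>); b \<in> F (g \<epsilon>); 0 \<le> u; 0 \<le> v; u + v = 1\<rbrakk> \<Longrightarrow> u *\<^sub>R a + v *\<^sub>R b \<in> F \<epsilon>"
    unfolding good_def by blast+
  \<comment> \<open>Tolerances for successive terms: \<open>g\<close> pays for one convex
    combination, and the halving drives the tolerances to 0, so that a point in all
    \<open>F (e n)\<close> is exactly fixed.\<close>
  define e where "e = rec_nat (1::real) (\<lambda>_ \<epsilon>. g (\<epsilon> / 2))"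
  have e_Suc: "e (Suc n) = g (e n / 2)" for n by (simp add: e_def)
  have e_pos: "e n > 0" for n
    by (induction n) (simp_all add: e_Suc g, simp add: e_def)
  have e_half: "e (Suc n) \<le> e n / 2" for n using g(2)[of "e n / 2"] e_pos[of n] by (simp add: e_Suc)
  have e_le: "e n \<le> (1/2) ^ n" for n
  proof (induction n)
    case (Suc n)
    then show ?case using e_half[of n] by simp
  qed (simp add: e_def)
  have step: "u *\<^sub>R a + v *\<^sub>R b \<in> F (e n)"
    if "a \<in> F (e (Suc n))" "b \<in> F (e (Suc n))" "0 \<le> u" "0 \<le> v" "u + v = 1" for a b u v n
    using g(3)[of "e n / 2" a b u v] that e_pos[of n] F_mono[of "e n / 2" "e n"] by (auto simp: e_Suc)
  have "\<exists>m. y m \<in> F (e n) \<and> N < m" for n N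
  proof -
    have "eventually (\<lambda>m. norm (y m - S (y m)) < e n) sequentially"
      using tendstoD[OF y(2) e_pos[of n]] by simp
    then obtain M where "\<And>m. m \<ge> M \<Longrightarrow> norm (y m - S (y m)) < e n"
      by (auto simp: eventually_sequentially)
    then show ?thesis using y(1) by (intro exI[of _ "max M (Suc N)"]) (auto simp: F_def less_imp_le)
  qed
  then have "\<exists>r. \<forall>n. y (r n) \<in> F (e n) \<and> r n < r (Suc n)"
    by (intro dependent_nat_choice) blast+
  then obtain r where r: "\<And>n. y (r n) \<in> F (e n)" "strict_mono r"
    by (metis strict_mono_Suc_iff)
  define H where "H n m = convex hull ((\<lambda>k. y (r k)) ` {n..<n+m})" for n m
  \<comment> \<open>The window starts at \<open>Suc n\<close> but has tolerance \<open>e n\<close>: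
    its first term and, by induction, the hull of the others both lie in
    \<open>F (e (Suc n))\<close>, and joining them loses one level. A window of length 1 is separate
    because \<open>convex_hull_insert\<close> needs a nonempty rest.\<close>
  have H: "H (Suc n) m \<subseteq> F (e n)" for n m
  proof (induction m arbitrary: n)
    case (Suc m)
    have "{Suc n..<Suc n + Suc m} = insert (Suc n) {Suc (Suc n)..<Suc (Suc n) + m}" by auto
    then have eq: "H (Suc n) (Suc m)
        = convex hull (insert (y (r (Suc n))) ((\<lambda>k. y (r k)) ` {Suc (Suc n)..<Suc (Suc n) + m}))"
      by (simp add: H_def)
    show ?case
    proof (cases "m = 0")
      case True
      have "e (Suc n) \<le> e n" using e_half[of n] e_pos[of n] by linarith
      then show ?thesis using True eq r(1)[of "Suc n"] F_mono by auto
    next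
      case False
      then have ne: "(\<lambda>k. y (r k)) ` {Suc (Suc n)..<Suc (Suc n) + m} \<noteq> {}" by auto
      show ?thesis
        unfolding eq convex_hull_insert[OF ne]
        using Suc[of "Suc n"] step r(1)[of "Suc n"] unfolding H_def by blast
    qed
  qed (simp add: H_def)
  have closed_F: "closed (F \<delta>)" for \<delta>
    unfolding F_def using S C(2)
    by (intro continuous_on_closed_Collect_le continuous_intros lipschitz_on_continuous_on)
  have hull_F: "closure (convex hull ((\<lambda>k. y (r k)) ` {Suc n..})) \<subseteq> F (e n)" for n
  proof -
    have H_mono: "H (Suc n) m \<subseteq> H (Suc n) m'" if "m \<le> m'" for m m'
      unfolding H_def using that by (intro hull_mono image_mono) auto
    \<comment> \<open>The hulls of finite windows increase with the length, so their union is convex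
      and contains the hull of the infinite tail.\<close>
    have "convex (\<Union>m. H (Suc n) m)"
    proof (rule convexI)
      fix a b and u v :: real
      assume "a \<in> (\<Union>m. H (Suc n) m)" "b \<in> (\<Union>m. H (Suc n) m)" and uv: "0 \<le> u" "0 \<le> v" "u + v = 1"
      then obtain i j where "a \<in> H (Suc n) i" "b \<in> H (Suc n) j" by blast
      then have "a \<in> H (Suc n) (max i j)" "b \<in> H (Suc n) (max i j)" using H_mono[of i "max i j"] H_mono[of j "max i j"] by auto
      then have "u *\<^sub>R a + v *\<^sub>R b \<in> H (Suc n) (max i j)"
        using uv unfolding H_def by (intro convexD convex_convex_hull)
      then show "u *\<^sub>R a + v *\<^sub>R b \<in> (\<Union>m. H (Suc n) m)" by blast
    qed
    moreover have "y (r k) \<in> (\<Union>m. H (Suc n) m)" if "k \<ge> Suc n" for k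
    proof -
      have "y (r k) \<in> H (Suc n) (Suc k)" unfolding H_def using that by (intro hull_inc) auto
      then show ?thesis by blast
    qed
    ultimately have "convex hull ((\<lambda>k. y (r k)) ` {Suc n..}) \<subseteq> (\<Union>m. H (Suc n) m)"
      by (intro hull_minimal) auto
    then show ?thesis
      using H closed_F by (intro closure_minimal) blast+
  qed
  define K where "K n = closure (convex hull ((\<lambda>k. y (r k)) ` {n..}))" for n
  have "(\<Inter>n. K n) \<noteq> {}"
  proof (rule uniformly_convex_nested_Inter[OF uc])
    show "bounded (K 0)"
      unfolding K_def using y(1) by (intro bounded_closure bounded_convex_hull bounded_subset[OF C(1)]) auto
    show "K (Suc n) \<subseteq> K n" for n
      unfolding K_def by (intro closure_mono hull_mono image_mono) auto
  qed (auto simp: K_def intro: convex_closure)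
  then obtain p where p: "\<And>n. p \<in> K n" by blast
  then have pF: "p \<in> F (e n)" for n using hull_F p[of "Suc n"] unfolding K_def by blast
  have "norm (p - S p) \<le> 0"
  proof (rule LIMSEQ_le_const)
    show "(\<lambda>n. (1/2::real) ^ n) \<longlonglongrightarrow> 0" by (rule LIMSEQ_power_zero) simp
    show "\<exists>N. \<forall>n\<ge>N. norm (p - S p) \<le> (1/2) ^ n"
      using pF e_le by (auto simp: F_def intro: order_trans)
  qed
  then show ?thesis
    using that[of r p] r(2) pF[of 0] p by (auto simp: F_def K_def)
qed

text \<open>Mixing \<open>S\<close> with a constant \<open>a\<close> of weight \<open>c k\<close>
  gives contractions of \<open>C\<close>. Their Banach fixed points are almost fixed by
  \<open>S\<close>, since \<open>C\<close> is bounded and \<open>c k\<close> tends to 0;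
  demiclosedness then supplies an exact fixed point.\<close>

lemma nonexpansive_fixed_point:
  fixes C :: "'a::banach set"
  assumes uc: "uniformly_convex TYPE('a)" and C: "bounded C" "closed C" "convex C" "C \<noteq> {}"
    and S: "1-lipschitz_on C S" "S \<in> C \<rightarrow> C"
  obtains p where "p \<in> C" "S p = p"
proof -
  obtain B where B: "B > 0" "\<And>x. x \<in> C \<Longrightarrow> norm x \<le> B"
    using \<open>bounded C\<close> bounded_pos by blast
  obtain a where a: "a \<in> C" using C(4) by blast
  define c where "c k = inverse (real (Suc k))" for k
  have c: "0 < c k" "c k \<le> 1" for k by (auto simp: c_def divide_simps)
  have "\<exists>!x\<in>C. (1 - c k) *\<^sub>R S x + c k *\<^sub>R a = x" for k
  proof (rule Banach_fix)
    show "complete C" using C(2) by (simp add: complete_eq_closed)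
    show "0 \<le> 1 - c k" "1 - c k < 1" using c[of k] by auto
    show "(\<lambda>x. (1 - c k) *\<^sub>R S x + c k *\<^sub>R a) ` C \<subseteq> C"
      using c[of k] a S(2) by (auto intro!: convexD[OF C(3)])
    show "dist ((1 - c k) *\<^sub>R S x + c k *\<^sub>R a) ((1 - c k) *\<^sub>R S y + c k *\<^sub>R a) \<le> (1 - c k) * dist x y"
      if "x \<in> C" "y \<in> C" for x y
      using lipschitz_onD[OF S(1) that] c[of k]
      by (simp add: dist_norm mult_left_mono flip: scaleR_diff_right)
  qed (use C in auto)
  then obtain y where y: "\<And>k. y k \<in> C" "\<And>k. (1 - c k) *\<^sub>R S (y k) + c k *\<^sub>R a = y k" by metis
  have "(\<lambda>k. y k - S (y k)) \<longlonglongrightarrow> 0"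
  proof (rule Lim_null_comparison)
    show "(\<lambda>k. c k * (2 * B)) \<longlonglongrightarrow> 0"
      unfolding c_def by (intro tendsto_mult_left_zero LIMSEQ_inverse_real_of_nat)
    have "norm (y k - S (y k)) \<le> c k * (2 * B)" for k
    proof -
      have "y k - S (y k) = c k *\<^sub>R (a - S (y k))"
        using y(2)[of k] by (simp add: algebra_simps)
      moreover have "norm (a - S (y k)) \<le> 2 * B"
        using norm_triangle_ineq4[of a "S (y k)"] B(2)[OF a] B(2)[OF funcset_mem[OF S(2) y(1)[of k]]]
        by simp
      ultimately show ?thesis using c[of k] by (simp add: mult_left_mono)
    qed
    then show "\<forall>\<^sub>F k in sequentially. norm (y k - S (y k)) \<le> c k * (2 * B)" by simp
  qed
  then show ?thesis
    using nonexpansive_demiclosed[OF uc C(1-3) S(1), of y] y(1) that by blast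
qed

lemma closed_fixed_points:
  fixes C :: "'a::real_normed_vector set"
  assumes "closed C" "1-lipschitz_on C S"
  shows "closed {x \<in> C. S x = x}"
proof -
  have "closed {x \<in> C. norm (x - S x) \<le> 0}"
    using assms by (intro continuous_on_closed_Collect_le continuous_intros lipschitz_on_continuous_on)
  moreover have "{x \<in> C. norm (x - S x) \<le> 0} = {x \<in> C. S x = x}" by auto
  ultimately show ?thesis by simp
qed

text \<open>Exactly fixed points meet every tolerance \<delta>, so their combinations are fixed up
  to every \<epsilon>.\<close>

lemma convex_fixed_points:
  fixes C :: "'a::real_normed_vector set"
  assumes uc: "uniformly_convex TYPE('a)" and C: "bounded C" "convex C" and S: "1-lipschitz_on C S"
  shows "convex {x \<in> C. S x = x}"
proof (rule convexI)
  fix x y and u v :: real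
  assume xy: "x \<in> {x \<in> C. S x = x}" "y \<in> {x \<in> C. S x = x}" and uv: "0 \<le> u" "0 \<le> v" "u + v = 1"
  define m where "m = u *\<^sub>R x + v *\<^sub>R y"
  have "v = 1 - u" using uv by simp
  have "norm (m - S m) \<le> 0 + \<epsilon>" if eps: "\<epsilon> > 0" for \<epsilon>
  proof -
    obtain \<delta> where \<delta>: "0 < \<delta>" "\<delta> \<le> \<epsilon>"
      "\<And>(S::'a \<Rightarrow> 'a) x y t. \<lbrakk>1-lipschitz_on C S; x \<in> C; y \<in> C; 0 \<le> t; t \<le> 1;
          norm (x - S x) \<le> \<delta>; norm (y - S y) \<le> \<delta>\<rbrakk>
         \<Longrightarrow> norm (t *\<^sub>R x + (1 - t) *\<^sub>R y - S (t *\<^sub>R x + (1 - t) *\<^sub>R y)) \<le> \<epsilon>"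
      using almost_fixed_convex_combination[OF uc C eps] by blast
    show ?thesis
      using \<delta>(3)[OF S, of x y u] xy uv \<delta>(1) by (simp add: m_def \<open>v = 1 - u\<close>)
  qed
  then have "norm (m - S m) \<le> 0" by (rule field_le_epsilon)
  then show "u *\<^sub>R x + v *\<^sub>R y \<in> {x \<in> C. S x = x}"
    using xy uv convexD[OF C(2), of x y u v] by (simp add: m_def)
qed

text \<open>By commutation \<open>R\<close> maps the fixed point set of \<open>S\<close> into
  itself, and this set is again bounded, closed, convex and nonempty.\<close>

lemma commuting_nonexpansive_fixed_point:
  fixes C :: "'a::banach set"
  assumes uc: "uniformly_convex TYPE('a)" and C: "bounded C" "closed C" "convex C" "C \<noteq> {}"
    and S: "1-lipschitz_on C S" "S \<in> C \<rightarrow> C" and R: "1-lipschitz_on C R" "R \<in> C \<rightarrow> C"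
    and comm: "\<And>x. x \<in> C \<Longrightarrow> S (R x) = R (S x)"
  obtains p where "p \<in> C" "S p = p" "R p = p"
proof -
  define F where "F = {x \<in> C. S x = x}"
  obtain p where p: "p \<in> F" "R p = p"
  proof (rule nonexpansive_fixed_point[OF uc])
    show "bounded F" using C(1) by (rule bounded_subset) (auto simp: F_def)
    show "closed F" "convex F"
      unfolding F_def using closed_fixed_points convex_fixed_points uc C S by blast+
    show "F \<noteq> {}"
      using nonexpansive_fixed_point[OF uc C S] by (auto simp: F_def)
    show "1-lipschitz_on F R" using R(1) by (rule lipschitz_on_subset) (auto simp: F_def)
    show "R \<in> F \<rightarrow> F" using R(2) comm by (force simp: F_def)
  qed
  then show ?thesis using that by (auto simp: F_def)
qed

section \<open>Orbits of nonexpansive maps\<close>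

text \<open>The distances to \<open>w\<close> decrease and converge. Whenever \<open>x n\<close> and
  \<open>a n\<close> are \<epsilon> apart, uniform convexity makes the distance drop by a fixed
  amount, which can happen only finitely often. Stated for sequences, so that either of the two maps
  can play the role of \<open>a\<close>.\<close>

lemma averaged_iteration_asymptotically_regular:
  fixes x a b :: "nat \<Rightarrow> 'a::real_normed_vector"
  assumes uc: "uniformly_convex TYPE('a)" and \<kappa>: "0 < \<kappa>" "0 \<le> \<mu>" "\<kappa> + \<mu> < 1"
    and a: "\<And>n. norm (a n - w) \<le> norm (x n - w)"
    and b: "\<And>n. norm (b n - w) \<le> norm (x n - w)"
    and x: "\<And>n. x (Suc n) = \<kappa> *\<^sub>R a n + \<mu> *\<^sub>R b n + (1 - \<kappa> - \<mu>) *\<^sub>R x n"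
  shows "(\<lambda>n. x n - a n) \<longlonglongrightarrow> 0"
proof -
  define r where "r n = norm (x n - w)" for n
  \<comment> \<open>A weight \<open>s\<close> can be split off from both \<open>a n\<close> and
    \<open>x n\<close>, leaving nonnegative coefficients; the split parts form a multiple of a
    midpoint.\<close>
  define s where "s = min \<kappa> (1 - \<kappa> - \<mu>)"
  have s: "0 < s" "s \<le> \<kappa>" "s \<le> 1 - \<kappa> - \<mu>" using \<kappa> by (auto simp: s_def)
  have dec: "r (Suc n) \<le> (1 - 2 * s) * r n + s * norm ((x n - w) + (a n - w))" for n
  proof -
    have "x (Suc n) - w = (\<kappa> - s) *\<^sub>R (a n - w) + \<mu> *\<^sub>R (b n - w) + (1 - \<kappa> - \<mu> - s) *\<^sub>R (x n - w)
        + s *\<^sub>R ((x n - w) + (a n - w))"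
      by (simp add: x algebra_simps)
    then have "r (Suc n) \<le> (\<kappa> - s) * norm (a n - w) + \<mu> * norm (b n - w) + (1 - \<kappa> - \<mu> - s) * norm (x n - w)
        + s * norm ((x n - w) + (a n - w))"
      unfolding r_def using s \<kappa> by (simp only:) (intro norm_triangle_mono; simp)
    also have "\<dots> \<le> (\<kappa> - s) * r n + \<mu> * r n + (1 - \<kappa> - \<mu> - s) * r n + s * norm ((x n - w) + (a n - w))"
      unfolding r_def using s \<kappa> a b by (intro add_mono mult_left_mono) auto
    finally show ?thesis by (simp add: algebra_simps)
  qed
  have dec': "r (Suc n) \<le> r n" for n
  proof -
    have "norm ((x n - w) + (a n - w)) \<le> 2 * r n"
      using norm_triangle_ineq[of "x n - w" "a n - w"] a[of n] by (simp add: r_def)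
    then have "s * norm ((x n - w) + (a n - w)) \<le> s * (2 * r n)"
      using s by (intro mult_left_mono) auto
    then show ?thesis using dec[of n] by (simp add: algebra_simps)
  qed
  then have "decseq r" by (rule decseq_SucI)
  then have r0: "r n \<le> r 0" for n by (simp add: decseqD)
  obtain L where L: "r \<longlonglongrightarrow> L"
    using decseq_convergent[OF \<open>decseq r\<close>, of 0] by (auto simp: r_def)
  have diff: "(\<lambda>n. r n - r (Suc n)) \<longlonglongrightarrow> L - L"
    by (intro tendsto_diff L LIMSEQ_Suc)
  show ?thesis
  proof (rule tendstoI)
    fix \<epsilon> :: real assume "\<epsilon> > 0"
    obtain \<delta> where \<delta>: "\<delta> > 0"
      "\<And>(u::'a) v \<rho>. \<lbrakk>\<rho> \<le> r 0 + 1; norm u \<le> \<rho>; norm v \<le> \<rho>; norm (u - v) \<ge> \<epsilon>\<rbrakk> \<Longrightarrow> norm (u + v) / 2 \<le> \<rho> - \<delta>"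
      using uniformly_convex_ball[OF uc \<open>\<epsilon> > 0\<close>, of "r 0 + 1"] by (auto simp: r_def add_nonneg_pos)
    have "\<forall>\<^sub>F n in sequentially. r n - r (Suc n) < 2 * s * \<delta>"
      using diff \<delta> s by (intro order_tendstoD(2)[OF diff]) auto
    then show "\<forall>\<^sub>F n in sequentially. dist (x n - a n) 0 < \<epsilon>"
    proof eventually_elim
      case (elim n)
      show ?case
      proof (rule ccontr)
        assume "\<not> ?thesis"
        then have "norm ((x n - w) - (a n - w)) \<ge> \<epsilon>" by simp
        then have "norm ((x n - w) + (a n - w)) / 2 \<le> r n - \<delta>"
          using a[of n] r0[of n] by (intro \<delta>(2)) (auto simp: r_def)
        then have "s * norm ((x n - w) + (a n - w)) \<le> s * (2 * (r n - \<delta>))"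
          using s by (intro mult_left_mono) auto
        then show False using dec[of n] elim by (simp add: algebra_simps)
      qed
    qed
  qed
qed

text \<open>Once a value near the infimum of a tail is reached, later values cannot climb far above
  it. The distances of interest below are monotone only up to such an error.\<close>

lemma convergent_almost_decreasing:
  fixes a :: "nat \<Rightarrow> real"
  assumes "bdd_below (range a)"
    and dec: "\<And>\<epsilon>. \<epsilon> > 0 \<Longrightarrow> \<exists>N. \<forall>n\<ge>N. \<forall>m. a (n + m) \<le> a n + \<epsilon>"
  shows "convergent a"
proof -
  have "Cauchy a"
  proof (rule metric_CauchyI)
    fix \<epsilon> :: real assume "\<epsilon> > 0"
    then obtain N where N: "\<And>n m. n \<ge> N \<Longrightarrow> a (n + m) \<le> a n + \<epsilon>/3"
      using dec[of "\<epsilon>/3"] by auto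
    define L where "L = Inf (a ` {N..})"
    have bdd: "bdd_below (a ` {N..})" using assms(1) by (rule bdd_below_mono) auto
    have "\<exists>y\<in>a ` {N..}. y < L + \<epsilon>/3"
      using \<open>\<epsilon> > 0\<close> by (intro cInf_lessD) (auto simp: L_def)
    then obtain n0 where n0: "n0 \<ge> N" "a n0 < L + \<epsilon>/3" by auto
    have "L \<le> a n" "a n < L + 2*\<epsilon>/3" if "n \<ge> n0" for n
    proof -
      show "L \<le> a n" unfolding L_def using that n0 bdd by (intro cInf_lower) auto
      show "a n < L + 2*\<epsilon>/3" using N[OF n0(1), of "n - n0"] n0(2) that by simp
    qed
    note near = this
    have "dist (a m) (a n) < \<epsilon>" if "m \<ge> n0" "n \<ge> n0" for m n
      using near[OF that(1)] near[OF that(2)] \<open>\<epsilon> > 0\<close> unfolding dist_real_def by linarith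
    then show "\<exists>M. \<forall>m\<ge>M. \<forall>n\<ge>M. dist (a m) (a n) < \<epsilon>" by blast
  qed
  then show ?thesis by (simp add: Cauchy_convergent_iff)
qed

lemma nonexpansive_funpow:
  assumes "1-lipschitz_on C S" "S \<in> C \<rightarrow> C"
  shows "1-lipschitz_on C (S ^^ m)" "S ^^ m \<in> C \<rightarrow> C"
proof (induction m)
  case (Suc m)
  {
    case 1
    have "(1 * 1)-lipschitz_on C (S \<circ> (S ^^ m))"
      using Suc assms by (intro lipschitz_on_compose) (auto intro: lipschitz_on_subset)
    then show ?case by simp
  next
    case 2
    show ?case using Suc(2) assms(2) by auto
  }
qed (auto intro: lipschitz_on_id)

text \<open>Reich's lemma: far along the orbit the distances \<open>norm (x n - p)\<close> hardly decrease, so every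
  power of \<open>S\<close> is almost affine on the segment from \<open>x n\<close> to \<open>p\<close>.\<close>

lemma convergent_norm_convex_combination:
  fixes C :: "'a::real_normed_vector set"
  assumes uc: "uniformly_convex TYPE('a)" and C: "bounded C" "convex C"
    and S: "1-lipschitz_on C S" "S \<in> C \<rightarrow> C" and x: "\<And>n. x n \<in> C" "\<And>n. x (Suc n) = S (x n)"
    and p: "p \<in> C" "S p = p" and q: "q \<in> C" "S q = q" and t: "0 \<le> t" "t \<le> 1"
  shows "convergent (\<lambda>n. norm (t *\<^sub>R x n + (1 - t) *\<^sub>R p - q))"
proof (rule convergent_almost_decreasing)
  show "bdd_below (range (\<lambda>n. norm (t *\<^sub>R x n + (1 - t) *\<^sub>R p - q)))"
    by (rule bdd_belowI[of _ 0]) auto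
  fix \<epsilon> :: real assume "\<epsilon> > 0"
  \<comment> \<open>\<delta> does not depend on the map, so one choice serves all powers
    \<open>S ^^ m\<close>.\<close>
  obtain \<delta> where \<delta>: "\<delta> > 0"
    "\<And>(S::'a \<Rightarrow> 'a) x y t. \<lbrakk>1-lipschitz_on C S; x \<in> C; y \<in> C; 0 \<le> t; t \<le> 1;
        norm (x - y) - norm (S x - S y) < \<delta>\<rbrakk>
       \<Longrightarrow> norm (S (t *\<^sub>R x + (1 - t) *\<^sub>R y) - (t *\<^sub>R S x + (1 - t) *\<^sub>R S y)) < \<epsilon>"
    using nonexpansive_almost_affine[OF uc C \<open>\<epsilon> > 0\<close>] by blast
  define r where "r n = norm (x n - p)" for n
  have fix_pow: "(S ^^ m) p = p" "(S ^^ m) q = q" for m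
    using p(2) q(2) by (induction m) auto
  have x_add: "x (n + m) = (S ^^ m) (x n)" for n m
    by (induction m) (simp_all add: x(2))
  have "decseq r"
    unfolding r_def using lipschitz_on_normD[OF S(1) x(1) p(1)] by (intro decseq_SucI) (simp add: x(2) p(2))
  then have "Cauchy r"
    using decseq_convergent[of r 0] by (auto simp: r_def Cauchy_convergent_iff convergent_def)
  then obtain N where N: "\<And>m n. m \<ge> N \<Longrightarrow> n \<ge> N \<Longrightarrow> \<bar>r m - r n\<bar> < \<delta>"
    using metric_CauchyD[OF _ \<delta>(1), of r] by (auto simp: dist_real_def)
  have "norm (t *\<^sub>R x (n + m) + (1 - t) *\<^sub>R p - q) \<le> norm (t *\<^sub>R x n + (1 - t) *\<^sub>R p - q) + \<epsilon>"
    if "n \<ge> N" for n m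
  proof -
    define c where "c = t *\<^sub>R x n + (1 - t) *\<^sub>R p"
    have c: "c \<in> C" unfolding c_def using t x(1) p(1) by (intro convexD[OF C(2)]) auto
    have "r n - r (n + m) < \<delta>" using N[of n "n + m"] that by simp
    then have "norm (x n - p) - norm ((S ^^ m) (x n) - (S ^^ m) p) < \<delta>"
      by (simp add: r_def x_add fix_pow)
    then have "norm ((S ^^ m) c - (t *\<^sub>R (S ^^ m) (x n) + (1 - t) *\<^sub>R (S ^^ m) p)) < \<epsilon>"
      unfolding c_def using nonexpansive_funpow(1)[OF S] x(1) p(1) t by (intro \<delta>(2)) auto
    then have "norm ((S ^^ m) c - (t *\<^sub>R x (n + m) + (1 - t) *\<^sub>R p)) < \<epsilon>"
      by (simp add: x_add fix_pow)
    moreover have "norm ((S ^^ m) c - q) \<le> norm (c - q)"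
      using lipschitz_on_normD[OF nonexpansive_funpow(1)[OF S] c q(1), of m] by (simp add: fix_pow)
    moreover have "norm (t *\<^sub>R x (n + m) + (1 - t) *\<^sub>R p - q)
        \<le> norm ((S ^^ m) c - q) + norm ((S ^^ m) c - (t *\<^sub>R x (n + m) + (1 - t) *\<^sub>R p))"
    proof -
      have "t *\<^sub>R x (n + m) + (1 - t) *\<^sub>R p - q
          = ((S ^^ m) c - q) - ((S ^^ m) c - (t *\<^sub>R x (n + m) + (1 - t) *\<^sub>R p))" by simp
      then show ?thesis by (simp only: norm_triangle_ineq4)
    qed
    ultimately show ?thesis
      unfolding c_def by linarith
  qed
  then show "\<exists>N. \<forall>n\<ge>N. \<forall>m. norm (t *\<^sub>R x (n + m) + (1 - t) *\<^sub>R p - q) \<le> norm (t *\<^sub>R x n + (1 - t) *\<^sub>R p - q) + \<epsilon>"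
    by blast
qed

section \<open>Differentiability of the norm and weak convergence\<close>

text \<open>The limit function \<open>l\<close> matters on the unit sphere only; \<open>f\<close>
  extends it homogeneously. The two-sided limit gives homogeneity for negative factors as well,
  convexity of the norm gives subadditivity, and the uniformity of the limit gives the
  derivative.\<close>

lemma frechet_norm_has_derivative_unit:
  assumes fr: "frechet_differentiable_norm TYPE('a::real_normed_vector)" and e: "norm (e::'a) = 1"
  obtains f where "(norm has_derivative f) (at e)" "f e = 1"
proof -
  obtain l where l0: "uniform_limit {y. norm y = 1} (\<lambda>s y. (norm (e + s *\<^sub>R y) - norm e) / s) l (at 0)"
    using fr e unfolding frechet_differentiable_norm_def by blast
  define q where "q s y = (norm (e + s *\<^sub>R y) - 1) / s" for s y
  have l: "uniform_limit {y. norm y = 1} q l (at 0)"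
    using l0 by (simp add: q_def[abs_def] e)
  define f where "f y = norm y * l (sgn y)" for y
  have at0: "filterlim (\<lambda>s. c * s) (at 0) (at (0::real))" if "c \<noteq> 0" for c
    using that by (auto simp: filterlim_at eventually_at_filter intro!: tendsto_eq_intros)
  have q_scale: "q s (c *\<^sub>R y) = c * q (c * s) y" for s c y
    by (simp add: q_def mult.commute e)
  have lim: "((\<lambda>s. q s y) \<longlongrightarrow> f y) (at 0)" for y
  proof (cases "y = 0")
    case False
    then have "((\<lambda>s. q s (sgn y)) \<longlongrightarrow> l (sgn y)) (at 0)"
      by (intro tendsto_uniform_limitI[OF l]) (simp add: norm_sgn)
    then have "((\<lambda>s. norm y * q (norm y * s) (sgn y)) \<longlongrightarrow> f y) (at 0)"
      unfolding f_def using False by (intro tendsto_mult_left filterlim_compose[OF _ at0]) auto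
    moreover have "q s y = norm y * q (norm y * s) (sgn y)" for s
      using q_scale[of s "norm y" "sgn y"] False by (simp add: sgn_div_norm)
    ultimately show ?thesis by simp
  qed (simp add: q_def f_def e)
  have f_scale: "f (c *\<^sub>R y) = c * f y" for c y
  proof (cases "c = 0")
    case False
    have "((\<lambda>s. q s (c *\<^sub>R y)) \<longlongrightarrow> c * f y) (at 0)"
      unfolding q_scale using False by (intro tendsto_mult_left filterlim_compose[OF lim at0])
    then show ?thesis using lim tendsto_unique by (metis at_neq_bot)
  qed (simp add: f_def)
  have f_sub: "f (y + z) \<le> f y + f z" for y z
  proof -
    \<comment> \<open>Doubling the increments makes \<open>e + s *\<^sub>R (y + z)\<close> a
      midpoint. Dividing by \<open>s\<close> preserves the inequality only for \<open>s > 0\<close>,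
      hence the limit from the right.\<close>
    have *: "q s (y + z) \<le> q (2 * s) y + q (2 * s) z" if "s > 0" for s
    proof -
      have "2 *\<^sub>R (e + s *\<^sub>R (y + z)) = (e + (2 * s) *\<^sub>R y) + (e + (2 * s) *\<^sub>R z)"
        by (simp add: algebra_simps scaleR_2)
      then have "2 * norm (e + s *\<^sub>R (y + z)) \<le> norm (e + (2 * s) *\<^sub>R y) + norm (e + (2 * s) *\<^sub>R z)"
        by (metis norm_scaleR norm_triangle_ineq abs_numeral)
      then have "(2 * norm (e + s *\<^sub>R (y + z)) - 2) / (2 * s)
          \<le> (norm (e + (2 * s) *\<^sub>R y) + norm (e + (2 * s) *\<^sub>R z) - 2) / (2 * s)"
        using that by (intro divide_right_mono) auto
      then show ?thesis by (simp add: q_def diff_divide_distrib add_divide_distrib)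
    qed
    have right: "at_right (0::real) \<le> at 0" by (simp add: at_le)
    show ?thesis
    proof (rule tendsto_le)
      show "((\<lambda>s. q s (y + z)) \<longlongrightarrow> f (y + z)) (at_right 0)" using right lim by (rule tendsto_mono)
      have "((\<lambda>s. q (2 * s) y + q (2 * s) z) \<longlongrightarrow> f y + f z) (at 0)"
        by (intro tendsto_add filterlim_compose[OF lim at0]) auto
      with right show "((\<lambda>s. q (2 * s) y + q (2 * s) z) \<longlongrightarrow> f y + f z) (at_right 0)" by (rule tendsto_mono)
      show "\<forall>\<^sub>F s in at_right 0. q s (y + z) \<le> q (2 * s) y + q (2 * s) z"
        using * by (simp add: eventually_at_filter)
    qed simp
  qed
  \<comment> \<open>\<open>f\<close> is odd, so subadditivity at \<open>y + z\<close> and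
    \<open>- z\<close> yields the reverse inequality.\<close>
  have f_add: "f (y + z) = f y + f z" for y z
    using f_sub[of y z] f_sub[of "y + z" "- z"] f_scale[of "-1" z] by simp
  have f_bound: "\<bar>f y\<bar> \<le> norm y" for y
  proof (rule tendsto_upperbound)
    show "((\<lambda>s. \<bar>q s y\<bar>) \<longlongrightarrow> \<bar>f y\<bar>) (at 0)" by (intro tendsto_rabs lim)
    have "\<bar>q s y\<bar> \<le> norm y" if "s \<noteq> 0" for s
      using norm_triangle_ineq3[of "e + s *\<^sub>R y" e] that e by (simp add: q_def field_simps)
    then show "\<forall>\<^sub>F s in at 0. \<bar>q s y\<bar> \<le> norm y" by (simp add: eventually_at_filter)
  qed simp
  have "bounded_linear f"
    by (rule bounded_linear_intro[of _ 1]) (simp_all add: f_add f_scale f_bound)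
  moreover have "\<exists>d>0. \<forall>y. norm (y - e) < d \<longrightarrow> norm (norm y - norm e - f (y - e)) \<le> \<epsilon> * norm (y - e)"
    if eps: "\<epsilon> > 0" for \<epsilon>
  proof -
    obtain d where d: "d > 0" "\<And>s y. \<lbrakk>s \<noteq> 0; \<bar>s\<bar> < d; norm y = 1\<rbrakk> \<Longrightarrow> \<bar>q s y - l y\<bar> < \<epsilon>"
      using uniform_limitD[OF l eps] by (auto simp: eventually_at dist_real_def)
    have "norm (norm y - norm e - f (y - e)) \<le> \<epsilon> * norm (y - e)" if "norm (y - e) < d" for y
    proof (cases "y = e")
      case False
      define h where "h = y - e"
      have h: "h \<noteq> 0" "norm h < d" using False that by (auto simp: h_def)
      have "\<bar>q (norm h) (sgn h) - l (sgn h)\<bar> < \<epsilon>"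
        using h by (intro d) (auto simp: norm_sgn)
      then have "norm h * \<bar>q (norm h) (sgn h) - l (sgn h)\<bar> \<le> norm h * \<epsilon>"
        by (intro mult_left_mono) auto
      moreover have "norm h * q (norm h) (sgn h) = norm y - 1"
        using h by (simp add: q_def sgn_div_norm h_def)
      then have "norm h * (q (norm h) (sgn h) - l (sgn h)) = norm y - 1 - f h"
        by (simp add: f_def right_diff_distrib)
      then have "norm h * \<bar>q (norm h) (sgn h) - l (sgn h)\<bar> = \<bar>norm y - 1 - f h\<bar>"
        by (metis abs_mult abs_norm_cancel)
      ultimately show ?thesis by (simp add: h_def e mult.commute)
    qed (simp add: f_def)
    then show ?thesis using d(1) by blast
  qed
  ultimately have "(norm has_derivative f) (at e)"
    unfolding has_derivative_at_alt by blast
  moreover have "f e = 1"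
  proof (rule tendsto_unique[OF _ lim])
    have "q s e = 1" if "s \<noteq> 0" "dist s 0 < 1" for s
    proof -
      have "e + s *\<^sub>R e = (1 + s) *\<^sub>R e" by (simp add: algebra_simps)
      then have "norm (e + s *\<^sub>R e) = \<bar>1 + s\<bar>" using e by simp
      also have "\<dots> = 1 + s" using that by (simp add: dist_real_def)
      finally have "norm (e + s *\<^sub>R e) = 1 + s" .
      then show ?thesis using that by (simp add: q_def)
    qed
    then have "\<forall>\<^sub>F s in at 0. q s e = 1" unfolding eventually_at by (intro exI[of _ 1]) auto
    then show "((\<lambda>s. q s e) \<longlongrightarrow> 1) (at 0)" by (rule tendsto_eventually)
  qed simp
  ultimately show ?thesis by (rule that)
qed

text \<open>Homogeneity of the norm transfers the derivative from the unit vector in direction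
  \<open>v\<close>.\<close>

lemma frechet_norm_has_derivative:
  assumes fr: "frechet_differentiable_norm TYPE('a::real_normed_vector)" and v: "(v::'a) \<noteq> 0"
  obtains f where "(norm has_derivative f) (at v)" "f v = norm v"
proof -
  have "norm (v /\<^sub>R norm v) = 1" using v by simp
  then obtain g where g: "(norm has_derivative g) (at (v /\<^sub>R norm v))" "g (v /\<^sub>R norm v) = 1"
    using frechet_norm_has_derivative_unit[OF fr] by blast
  have "((\<lambda>x. x /\<^sub>R norm v) has_derivative (\<lambda>x. x /\<^sub>R norm v)) (at v)"
    by (intro derivative_intros)
  then have "((\<lambda>x. norm v * norm (x /\<^sub>R norm v)) has_derivative (\<lambda>x. norm v * g (x /\<^sub>R norm v))) (at v)"
    using has_derivative_compose[where f = "\<lambda>x. x /\<^sub>R norm v" and x = v, OF _ g(1)]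
    by (intro has_derivative_mult_right)
  moreover have "(\<lambda>x::'a. norm v * norm (x /\<^sub>R norm v)) = norm" using v by (auto simp: fun_eq_iff)
  ultimately have "(norm has_derivative (\<lambda>x. norm v * g (x /\<^sub>R norm v))) (at v)" by (simp only:)
  then show ?thesis using that g(2) by simp
qed

text \<open>For a small fixed \<open>t\<close> the convergent norms equal
  \<open>norm (p - q) + t * f (x n - p)\<close> up to a small multiple of \<open>t\<close>. Dividing
  by \<open>t\<close> passes the Cauchy property to \<open>f (x n)\<close>.\<close>

lemma convergent_norm_derivative:
  fixes x :: "nat \<Rightarrow> 'a::real_normed_vector"
  assumes f: "(norm has_derivative f) (at (p - q))" and bdd: "bounded (range x)"
    and conv: "\<And>t. \<lbrakk>0 \<le> t; t \<le> 1\<rbrakk> \<Longrightarrow> convergent (\<lambda>n. norm (t *\<^sub>R x n + (1 - t) *\<^sub>R p - q))"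
  shows "convergent (\<lambda>n. f (x n))"
proof -
  interpret f: bounded_linear f using f by (rule has_derivative_bounded_linear)
  obtain B where B: "B > 0" "\<And>n. norm (x n) \<le> B" using bdd bounded_pos by (metis rangeI)
  define M where "M = B + norm p"
  have M: "M > 0" "norm (x n - p) \<le> M" for n
    using B norm_triangle_ineq4[of "x n" p] unfolding M_def by (auto simp: add_pos_nonneg intro: order_trans)
  have "Cauchy (\<lambda>n. f (x n))"
  proof (rule metric_CauchyI)
    fix \<epsilon> :: real assume "\<epsilon> > 0"
    \<comment> \<open>This slope gives an error of at most \<open>t * \<epsilon> / 4\<close> at each
      of two indices; the Cauchy bound for \<open>u\<close> contributes the remaining
      \<open>t * \<epsilon> / 2\<close>.\<close>
    then have "\<epsilon> / (4*M) > 0" using M by simp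
    then obtain d where d: "d > 0"
      "\<And>y. norm (y - (p - q)) < d \<Longrightarrow> norm (norm y - norm (p - q) - f (y - (p - q))) \<le> \<epsilon> / (4*M) * norm (y - (p - q))"
      using f unfolding has_derivative_at_alt by blast
    \<comment> \<open>One \<open>t\<close> for all \<open>n\<close>:
      \<open>t *\<^sub>R (x n - p)\<close> stays inside the radius \<open>d\<close>, and
      \<open>t \<le> 1\<close> keeps \<open>conv\<close> applicable.\<close>
    define t where "t = min 1 (d / (2*M))"
    have t: "0 < t" "t \<le> 1" "t * M < d"
    proof -
      have "t * M \<le> d / (2*M) * M" using M(1) by (intro mult_right_mono) (auto simp: t_def)
      also have "\<dots> < d" using M(1) d(1) by simp
      finally show "t * M < d" .
    qed (use M(1) d(1) in \<open>auto simp: t_def\<close>)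
    define u where "u n = norm (t *\<^sub>R x n + (1 - t) *\<^sub>R p - q)" for n
    have est: "\<bar>u n - norm (p - q) - t * f (x n - p)\<bar> \<le> t * \<epsilon> / 4" for n
    proof -
      have eq: "t *\<^sub>R x n + (1 - t) *\<^sub>R p - q - (p - q) = t *\<^sub>R (x n - p)" by (simp add: algebra_simps)
      have le: "norm (t *\<^sub>R (x n - p)) \<le> t * M" using t M(2)[of n] by (simp add: mult_left_mono)
      then have "\<bar>u n - norm (p - q) - t * f (x n - p)\<bar> \<le> \<epsilon> / (4*M) * norm (t *\<^sub>R (x n - p))"
        using d(2)[of "t *\<^sub>R x n + (1 - t) *\<^sub>R p - q"] t(3) unfolding eq u_def f.scaleR by simp
      also have "\<dots> \<le> \<epsilon> / (4*M) * (t * M)"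
        using le \<open>\<epsilon> / (4*M) > 0\<close> by (intro mult_left_mono) auto
      finally show ?thesis using M(1) by (simp add: mult.commute)
    qed
    have "Cauchy u" using conv[of t] t unfolding u_def Cauchy_convergent_iff by simp
    moreover have "t * \<epsilon> / 2 > 0" using t \<open>\<epsilon> > 0\<close> by simp
    ultimately have "\<exists>N. \<forall>m\<ge>N. \<forall>n\<ge>N. dist (u m) (u n) < t * \<epsilon> / 2" by (rule metric_CauchyD)
    then obtain N where N: "\<And>m n. \<lbrakk>m \<ge> N; n \<ge> N\<rbrakk> \<Longrightarrow> \<bar>u m - u n\<bar> < t * \<epsilon> / 2"
      unfolding dist_real_def by blast
    have "dist (f (x m)) (f (x n)) < \<epsilon>" if "m \<ge> N" "n \<ge> N" for m n
    proof -
      have "\<bar>t * f (x m - p) - t * f (x n - p)\<bar> < t * \<epsilon>"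
        using N[OF that] est[of m] est[of n] by linarith
      then have "t * \<bar>f (x m) - f (x n)\<bar> < t * \<epsilon>"
        using t(1) by (simp add: f.diff abs_mult flip: right_diff_distrib)
      then show ?thesis using t(1) by (simp add: dist_real_def)
    qed
    then show "\<exists>M. \<forall>m\<ge>M. \<forall>n\<ge>M. dist (f (x m)) (f (x n)) < \<epsilon>" by blast
  qed
  then show ?thesis by (simp add: Cauchy_convergent_iff)
qed

text \<open>The preimage of a closed ball around \<open>L\<close> under \<open>f\<close> is closed
  and convex; containing a tail of \<open>x\<close>, it contains the closed hull of that
  tail.\<close>

lemma limit_on_tail_hulls:
  fixes x :: "nat \<Rightarrow> 'a::real_normed_vector" and f :: "'a \<Rightarrow> real"
  assumes f: "bounded_linear f" and lim: "(\<lambda>n. f (x n)) \<longlonglongrightarrow> L"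
    and z: "\<And>n. z \<in> closure (convex hull (x ` {n..}))"
  shows "f z = L"
proof -
  have "dist (f z) L \<le> 0 + \<epsilon>" if eps: "\<epsilon> > 0" for \<epsilon>
  proof -
    obtain N where N: "\<And>n. n \<ge> N \<Longrightarrow> dist (f (x n)) L < \<epsilon>"
      using tendstoD[OF lim eps] by (auto simp: eventually_sequentially)
    have "convex (f -` cball L \<epsilon>)"
      using f by (intro convex_linear_vimage convex_cball bounded_linear.linear)
    then have "convex hull (x ` {N..}) \<subseteq> f -` cball L \<epsilon>"
      using N by (intro hull_minimal) (auto simp: dist_commute less_imp_le)
    moreover have "closed (f -` cball L \<epsilon>)"
      using f by (intro closed_vimage closed_cball linear_continuous_on)
    ultimately have "closure (convex hull (x ` {N..})) \<subseteq> f -` cball L \<epsilon>" by (rule closure_minimal)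
    then show ?thesis using z[of N] by (auto simp: dist_commute)
  qed
  then have "dist (f z) L \<le> 0" by (rule field_le_epsilon)
  then show ?thesis by simp
qed

text \<open>The derivative \<open>f\<close> of the norm at \<open>p - q\<close> converges along the orbit, hence takes the same value
  at \<open>p\<close> and at \<open>q\<close>; but \<open>f (p - q) = norm (p - q)\<close>.\<close>

lemma unique_fixed_point_in_tail_hulls:
  fixes C :: "'a::real_normed_vector set"
  assumes uc: "uniformly_convex TYPE('a)" and fr: "frechet_differentiable_norm TYPE('a)"
    and C: "bounded C" "convex C"
    and S: "1-lipschitz_on C S" "S \<in> C \<rightarrow> C" and x: "\<And>n. x n \<in> C" "\<And>n. x (Suc n) = S (x n)"
    and p: "p \<in> C" "S p = p" "\<And>n. p \<in> closure (convex hull (x ` {n..}))"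
    and q: "q \<in> C" "S q = q" "\<And>n. q \<in> closure (convex hull (x ` {n..}))"
  shows "p = q"
proof (rule ccontr)
  assume "p \<noteq> q"
  then obtain f where f: "(norm has_derivative f) (at (p - q))" "f (p - q) = norm (p - q)"
    using frechet_norm_has_derivative[OF fr, of "p - q"] by auto
  have bl: "bounded_linear f" using f(1) by (rule has_derivative_bounded_linear)
  have "bounded (range x)" using C(1) by (rule bounded_subset) (use x(1) in auto)
  then have "convergent (\<lambda>n. f (x n))"
    using convergent_norm_convex_combination[where x = x, OF uc C S x p(1,2) q(1,2)]
    by (intro convergent_norm_derivative[OF f(1)])
  then obtain L where L: "(\<lambda>n. f (x n)) \<longlonglongrightarrow> L" by (auto simp: convergent_def)
  have "f (p - q) = f p - f q" by (simp add: bl linear_diff bounded_linear.linear)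
  also have "\<dots> = 0" using limit_on_tail_hulls[OF bl L p(3)] limit_on_tail_hulls[OF bl L q(3)] by simp
  finally show False using f(2) \<open>p \<noteq> q\<close> by simp
qed

text \<open>If \<open>f (x n)\<close> stayed away from \<open>f p\<close> along a subsequence, a
  refinement would have a limit \<open>L\<close> and, in all its tail hulls, a fixed point
  \<open>q\<close> with \<open>f q = L\<close>. Uniqueness gives \<open>q = p\<close>, a
  contradiction.\<close>

theorem nonexpansive_orbit_weakly_convergent:
  fixes C :: "'a::banach set"
  assumes uc: "uniformly_convex TYPE('a)" and fr: "frechet_differentiable_norm TYPE('a)"
    and C: "bounded C" "closed C" "convex C"
    and S: "1-lipschitz_on C S" "S \<in> C \<rightarrow> C" and x: "\<And>n. x n \<in> C" "\<And>n. x (Suc n) = S (x n)"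
    and reg: "(\<lambda>n. x n - S (x n)) \<longlonglongrightarrow> 0"
  obtains z where "z \<in> C" "S z = z" "weakly_converges x z"
proof -
  \<comment> \<open>Both families of hulls are needed: those of \<open>x\<close> for uniqueness,
    those of the subsequence to read off the limit of \<open>f\<close>.\<close>
  have cluster: "\<exists>(r :: nat \<Rightarrow> nat) p. strict_mono r \<and> p \<in> C \<and> S p = p \<and> (\<forall>n. p \<in> closure (convex hull (x ` {n..})))
      \<and> (\<forall>n. p \<in> closure (convex hull ((\<lambda>k. x (s (r k))) ` {n..})))"
    if "strict_mono (s :: nat \<Rightarrow> nat)" for s
  proof -
    have "(\<lambda>k. x (s k) - S (x (s k))) \<longlonglongrightarrow> 0"
      using LIMSEQ_subseq_LIMSEQ[OF reg that] by (simp add: o_def)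
    then obtain r p where rp: "strict_mono (r :: nat \<Rightarrow> nat)" "p \<in> C" "S p = p"
      "\<And>n. p \<in> closure (convex hull ((\<lambda>k. x (s (r k))) ` {n..}))"
      using nonexpansive_demiclosed[OF uc C S(1), of "\<lambda>k. x (s k)"] x(1) by blast
    have "(\<lambda>k. x (s (r k))) ` {n..} \<subseteq> x ` {n..}" for n
      using seq_suble[OF strict_mono_o[OF that rp(1)]] by (fastforce intro: order_trans)
    then have "p \<in> closure (convex hull (x ` {n..}))" for n
      using rp(4)[of n] closure_mono[OF hull_mono] by blast
    then show ?thesis using rp by (intro exI[of _ r] exI[of _ p] conjI allI)
  qed
  obtain p where p: "p \<in> C" "S p = p" "\<And>n. p \<in> closure (convex hull (x ` {n..}))"
    using cluster[of "\<lambda>n. n"] by (auto simp: strict_mono_def)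
  have "(\<lambda>n. f (x n)) \<longlonglongrightarrow> f p" if f: "bounded_linear f" for f :: "'a \<Rightarrow> real"
  proof (rule ccontr)
    assume "\<not> ?thesis"
    then obtain \<epsilon> where \<epsilon>: "\<epsilon> > 0" "\<exists>\<^sub>F n in sequentially. dist (f (x n)) (f p) \<ge> \<epsilon>"
      unfolding tendsto_iff by (auto simp: not_eventually not_less)
    then have "infinite {n. dist (f (x n)) (f p) \<ge> \<epsilon>}"
      by (simp add: frequently_cofinite flip: cofinite_eq_sequentially)
    then obtain s where s: "strict_mono (s :: nat \<Rightarrow> nat)" "\<And>n. dist (f (x (s n))) (f p) \<ge> \<epsilon>"
      using infinite_enumerate by blast
    have "bounded (f ` C)" using C(1) f by (rule bounded_linear_image)
    then have "bounded (range (\<lambda>n. f (x (s n))))" by (rule bounded_subset) (use x(1) in auto)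
    then obtain L s' where s': "strict_mono (s' :: nat \<Rightarrow> nat)" "(\<lambda>n. f (x (s (s' n)))) \<longlonglongrightarrow> L"
      using bounded_imp_convergent_subsequence unfolding o_def by blast
    have "strict_mono (\<lambda>n. s (s' n))" using strict_mono_o[OF s(1) s'(1)] by (simp add: o_def)
    then obtain r q where r: "strict_mono (r :: nat \<Rightarrow> nat)" and q: "q \<in> C" "S q = q"
      "\<And>n. q \<in> closure (convex hull (x ` {n..}))"
      "\<And>n. q \<in> closure (convex hull ((\<lambda>k. x (s (s' (r k)))) ` {n..}))"
      using cluster[of "\<lambda>n. s (s' n)"] by blast
    have "(\<lambda>k. f (x (s (s' (r k))))) \<longlonglongrightarrow> L"
      using LIMSEQ_subseq_LIMSEQ[OF s'(2) r] by (simp add: o_def)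
    then have "f q = L" using q(4) by (rule limit_on_tail_hulls[OF f])
    moreover have "q = p"
      using uc fr C(1,3) S x q(1-3) p by (rule unique_fixed_point_in_tail_hulls)
    ultimately have "\<forall>\<^sub>F n in sequentially. dist (f (x (s (s' n)))) (f p) < \<epsilon>"
      using tendstoD[OF s'(2) \<epsilon>(1)] by simp
    then obtain n where "dist (f (x (s (s' n)))) (f p) < \<epsilon>"
      by (auto simp: eventually_sequentially)
    then show False using s(2)[of "s' n"] by simp
  qed
  then show ?thesis using that p(1,2) by (simp add: weakly_converges_def)
qed

section \<open>One-parameter semigroups\<close>

text \<open>The set where \<open>f\<close> equals \<open>f 0\<close> is closed because singletons
  are closed in a Hausdorff space. Modulo \<beta> it contains the multiples of \<alpha>, which are
  dense by Kronecker's theorem.\<close>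

lemma irrational_periods_imp_constant:
  fixes f :: "real \<Rightarrow> 'a"
  assumes \<tau>: "Hausdorff_space \<tau>" and f: "continuous_map (top_of_set {0..}) \<tau> f"
    and \<alpha>\<beta>: "\<alpha> > 0" "\<beta> > 0" "\<alpha> / \<beta> \<notin> \<rat>"
    and period: "\<And>t. t \<ge> 0 \<Longrightarrow> f (t + \<alpha>) = f t" "\<And>t. t \<ge> 0 \<Longrightarrow> f (t + \<beta>) = f t"
    and "t \<ge> 0"
  shows "f t = f 0"
proof -
  have multiple_\<alpha>: "f (t + real n * \<alpha>) = f t" if "t \<ge> 0" for t n
  proof (induction n)
    case (Suc n)
    then show ?case using period(1)[of "t + real n * \<alpha>"] that \<alpha>\<beta> by (simp add: algebra_simps)
  qed simp
  have multiple_\<beta>: "f (t + real n * \<beta>) = f t" if "t \<ge> 0" for t n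
  proof (induction n)
    case (Suc n)
    then show ?case using period(2)[of "t + real n * \<beta>"] that \<alpha>\<beta> by (simp add: algebra_simps)
  qed simp
  \<comment> \<open>For \<open>s \<ge> 0\<close> the floor is a natural number, so only forward
    shifts within the half-line are used.\<close>
  have mod_\<beta>: "f (s * \<beta>) = f (frac s * \<beta>)" if "s \<ge> 0" for s
  proof -
    have "s * \<beta> = frac s * \<beta> + real (nat \<lfloor>s\<rfloor>) * \<beta>"
      using that by (simp add: frac_def algebra_simps)
    then show ?thesis using multiple_\<beta>[of "frac s * \<beta>"] \<alpha>\<beta> by simp
  qed
  have "f 0 \<in> topspace \<tau>" using f by (auto simp: continuous_map_def)
  then have "closedin \<tau> {f 0}" using \<tau> by (simp add: closedin_Hausdorff_singleton)
  then have "closedin (top_of_set {0..}) {s \<in> topspace (top_of_set {0..}). f s \<in> {f 0}}"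
    by (rule closedin_continuous_map_preimage[OF f])
  then have "closed {s \<in> {0..}. f s = f 0}"
    by (simp add: closedin_closed_eq)
  then have "closed ((\<lambda>u. u * \<beta>) -` {s \<in> {0..}. f s = f 0})"
    by (intro closed_vimage continuous_intros)
  moreover have "range (\<lambda>n. frac (real n * (\<alpha> / \<beta>))) \<subseteq> (\<lambda>u. u * \<beta>) -` {s \<in> {0..}. f s = f 0}"
  proof clarsimp
    fix n
    have "f (frac (real n * (\<alpha> / \<beta>)) * \<beta>) = f (0 + real n * \<alpha>)"
      using mod_\<beta>[of "real n * (\<alpha> / \<beta>)"] \<alpha>\<beta> by simp
    then show "0 \<le> frac (real n * \<alpha> / \<beta>) * \<beta> \<and> f (frac (real n * \<alpha> / \<beta>) * \<beta>) = f 0"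
      using multiple_\<alpha>[of 0 n] \<alpha>\<beta> by simp
  qed
  ultimately have "closure (range (\<lambda>n. frac (real n * (\<alpha> / \<beta>)))) \<subseteq> (\<lambda>u. u * \<beta>) -` {s \<in> {0..}. f s = f 0}"
    by (intro closure_minimal)
  moreover have "frac (t / \<beta>) \<in> {0..1}" by (simp add: frac_lt_1 less_imp_le)
  ultimately have "f (frac (t / \<beta>) * \<beta>) = f 0"
    unfolding Kronecker_approx_1[OF \<alpha>\<beta>(3)] by blast
  then show ?thesis using mod_\<beta>[of "t / \<beta>"] \<open>t \<ge> 0\<close> \<alpha>\<beta> by simp
qed

text \<open>The orbit of \<open>z\<close> is constant with value \<open>T 0 z\<close>. Since
  \<open>T 0\<close> need not be the identity, this value is identified with \<open>z\<close> at
  time \<alpha>.\<close>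

lemma common_fixed_point_of_two:
  assumes "Hausdorff_space \<tau>" and T: "nonexpansive_semigroup \<tau> C T"
    and \<alpha>\<beta>: "\<alpha> > 0" "\<beta> > 0" "\<alpha> / \<beta> \<notin> \<rat>"
    and z: "z \<in> C" "T \<alpha> z = z" "T \<beta> z = z"
  shows "common_fixed_point C T z"
proof -
  have add: "T (s + t) z = T s (T t z)" if "s \<ge> 0" "t \<ge> 0" for s t
    using T that z unfolding nonexpansive_semigroup_def by blast
  have "continuous_map (top_of_set {0..}) (subtopology \<tau> C) (\<lambda>t. T t z)"
    using T z unfolding nonexpansive_semigroup_def by blast
  then have cont: "continuous_map (top_of_set {0..}) \<tau> (\<lambda>t. T t z)"
    by (rule continuous_map_into_fulltopology)
  have const: "T t z = T 0 z" if "t \<ge> 0" for t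
    using irrational_periods_imp_constant[OF assms(1) cont \<alpha>\<beta> _ _ that] add z \<alpha>\<beta> by simp
  have "T t z = z" if "t \<ge> 0" for t
    using const[of t] const[of \<alpha>] that \<alpha>\<beta> z by simp
  then show ?thesis using z by (simp add: common_fixed_point_def)
qed

section \<open>Weak convergence of the averaged iteration\<close>

theorem theorem7:
  fixes \<tau> :: "'a::banach topology"
    and C :: "'a set"
    and T :: "real \<Rightarrow> 'a \<Rightarrow> 'a"
    and x :: "nat \<Rightarrow> 'a"
    and \<alpha> \<beta> \<kappa> \<mu> :: real
  assumes "uniformly_convex TYPE('a)"
    and "frechet_differentiable_norm TYPE('a)"
    and "topspace \<tau> = UNIV" and "Hausdorff_space \<tau>"
    and "bounded C" and "closed C" and "convex C"
    and "nonexpansive_semigroup \<tau> C T"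
    and "\<alpha> > 0" and "\<beta> > 0" and "\<alpha> / \<beta> \<notin> \<rat>"
    and "\<kappa> > 0" and "\<mu> > 0" and "\<kappa> + \<mu> < 1"
    and "x 1 \<in> C"
    and "\<And>n. n \<ge> 1 \<Longrightarrow>
           x (n + 1) = \<kappa> *\<^sub>R T \<alpha> (x n) + \<mu> *\<^sub>R T \<beta> (x n) + (1 - \<kappa> - \<mu>) *\<^sub>R x n"
  shows "\<exists>z. common_fixed_point C T z \<and> weakly_converges x z"
proof -
  note uc = assms(1) and fr = assms(2) and C = assms(5-7) and T = assms(8)
    and \<alpha>\<beta> = assms(9-11) and \<kappa>\<mu> = assms(12-14)
  have lip: "1-lipschitz_on C (T t)" and maps: "T t \<in> C \<rightarrow> C" if "t \<ge> 0" for t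
    using T that unfolding nonexpansive_semigroup_def by (auto intro!: lipschitz_onI simp: dist_norm)
  have comm: "T \<alpha> (T \<beta> y) = T \<beta> (T \<alpha> y)" if "y \<in> C" for y
    using T that \<alpha>\<beta> unfolding nonexpansive_semigroup_def by (metis add.commute less_imp_le)
  have \<alpha>: "1-lipschitz_on C (T \<alpha>)" "T \<alpha> \<in> C \<rightarrow> C" and \<beta>: "1-lipschitz_on C (T \<beta>)" "T \<beta> \<in> C \<rightarrow> C"
    using lip maps \<alpha>\<beta> by auto
  obtain w where w: "w \<in> C" "T \<alpha> w = w" "T \<beta> w = w"
    using commuting_nonexpansive_fixed_point[OF uc C _ \<alpha> \<beta> comm] \<open>x 1 \<in> C\<close> by auto
  define U where "U y = \<kappa> *\<^sub>R T \<alpha> y + \<mu> *\<^sub>R T \<beta> y + (1 - \<kappa> - \<mu>) *\<^sub>R y" for y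
  have U_maps: "U \<in> C \<rightarrow> C"
  proof
    fix y assume "y \<in> C"
    then have "T \<alpha> y \<in> C" "T \<beta> y \<in> C" using \<alpha> \<beta> by auto
    \<comment> \<open>\<open>convexD\<close> combines two points at a time, so the two images are
      first merged with normalised weights.\<close>
    moreover have "\<kappa> / (\<kappa> + \<mu>) + \<mu> / (\<kappa> + \<mu>) = 1"
    proof -
      have "\<kappa> + \<mu> \<noteq> 0" using \<kappa>\<mu> by linarith
      then show ?thesis by (metis add_divide_distrib divide_self)
    qed
    moreover have "(\<kappa> / (\<kappa> + \<mu>)) *\<^sub>R T \<alpha> y + (\<mu> / (\<kappa> + \<mu>)) *\<^sub>R T \<beta> y \<in> C"
      using calculation \<kappa>\<mu> by (intro convexD[OF C(3)]) simp_all
    ultimately have "(\<kappa> + \<mu>) *\<^sub>R ((\<kappa> / (\<kappa> + \<mu>)) *\<^sub>R T \<alpha> y + (\<mu> / (\<kappa> + \<mu>)) *\<^sub>R T \<beta> y) + (1 - \<kappa> - \<mu>) *\<^sub>R y \<in> C"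
      using \<kappa>\<mu> \<open>y \<in> C\<close> by (intro convexD[OF C(3)]) simp_all
    then show "U y \<in> C" using \<kappa>\<mu> by (simp add: U_def scaleR_add_right)
  qed
  have "1-lipschitz_on C U"
  proof (rule lipschitz_onI)
    fix y z assume yz: "y \<in> C" "z \<in> C"
    have "U y - U z = \<kappa> *\<^sub>R (T \<alpha> y - T \<alpha> z) + \<mu> *\<^sub>R (T \<beta> y - T \<beta> z) + (1 - \<kappa> - \<mu>) *\<^sub>R (y - z)"
      by (simp add: U_def algebra_simps)
    then have "norm (U y - U z) \<le> \<kappa> * norm (T \<alpha> y - T \<alpha> z) + \<mu> * norm (T \<beta> y - T \<beta> z) + (1 - \<kappa> - \<mu>) * norm (y - z)"
      using \<kappa>\<mu> by (simp only:) (intro norm_triangle_mono; simp)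
    also have "\<dots> \<le> \<kappa> * norm (y - z) + \<mu> * norm (y - z) + (1 - \<kappa> - \<mu>) * norm (y - z)"
      using \<kappa>\<mu> lipschitz_on_normD[OF \<alpha>(1) yz] lipschitz_on_normD[OF \<beta>(1) yz]
      by (intro add_mono mult_left_mono) auto
    finally show "dist (U y) (U z) \<le> 1 * dist y z" by (simp add: dist_norm algebra_simps)
  qed simp
  \<comment> \<open>Stated for every orbit of \<open>U\<close>: it serves both the iteration and the
    constant orbit at a fixed point of \<open>U\<close>.\<close>
  have regular: "(\<lambda>n. y n - T \<alpha> (y n)) \<longlonglongrightarrow> 0" "(\<lambda>n. y n - T \<beta> (y n)) \<longlonglongrightarrow> 0"
    if y: "\<And>n. y n \<in> C" "\<And>n. y (Suc n) = U (y n)" for y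
  proof -
    have le: "norm (T \<alpha> (y n) - w) \<le> norm (y n - w)" "norm (T \<beta> (y n) - w) \<le> norm (y n - w)" for n
      using lipschitz_on_normD[OF \<alpha>(1) y(1) w(1)] lipschitz_on_normD[OF \<beta>(1) y(1) w(1)] w by auto
    show "(\<lambda>n. y n - T \<alpha> (y n)) \<longlonglongrightarrow> 0"
      using \<kappa>\<mu> le by (intro averaged_iteration_asymptotically_regular[OF uc, where b = "\<lambda>n. T \<beta> (y n)" and \<kappa> = \<kappa> and \<mu> = \<mu>])
        (auto simp: y(2) U_def)
    show "(\<lambda>n. y n - T \<beta> (y n)) \<longlonglongrightarrow> 0"
      using \<kappa>\<mu> le by (intro averaged_iteration_asymptotically_regular[OF uc, where b = "\<lambda>n. T \<alpha> (y n)" and \<kappa> = \<mu> and \<mu> = \<kappa>])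
        (auto simp: y(2) U_def algebra_simps)
  qed
  \<comment> \<open>The recursion starts at index 1 and leaves \<open>x 0\<close> arbitrary, so the
    orbit of \<open>U\<close> is the shifted sequence.\<close>
  define y where "y n = x (Suc n)" for n
  have y_Suc: "y (Suc n) = U (y n)" for n
    using assms(16)[of "Suc n"] by (simp add: y_def U_def)
  have yC: "y n \<in> C" for n
    by (induction n) (use assms(15) U_maps in \<open>auto simp: y_Suc\<close>, simp add: y_def)
  have "y n - U (y n) = \<kappa> *\<^sub>R (y n - T \<alpha> (y n)) + \<mu> *\<^sub>R (y n - T \<beta> (y n))" for n
    by (simp add: U_def algebra_simps)
  moreover have "(\<lambda>n. \<kappa> *\<^sub>R (y n - T \<alpha> (y n)) + \<mu> *\<^sub>R (y n - T \<beta> (y n))) \<longlonglongrightarrow> \<kappa> *\<^sub>R 0 + \<mu> *\<^sub>R 0"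
    using regular[of y, OF yC y_Suc] by (intro tendsto_intros)
  ultimately have "(\<lambda>n. y n - U (y n)) \<longlonglongrightarrow> 0" by simp
  then obtain z where z: "z \<in> C" "U z = z" "weakly_converges y z"
    using nonexpansive_orbit_weakly_convergent[OF uc fr C \<open>1-lipschitz_on C U\<close> U_maps, of y] yC y_Suc by blast
  \<comment> \<open>Asymptotic regularity of the constant orbit at \<open>z\<close> says that a
    constant tends to 0, so \<open>z\<close> is fixed by both maps.\<close>
  have "(\<lambda>n::nat. z - T \<alpha> z) \<longlonglongrightarrow> 0" "(\<lambda>n::nat. z - T \<beta> z) \<longlonglongrightarrow> 0"
    using regular[of "\<lambda>_. z"] z by auto
  then have "T \<alpha> z = z" "T \<beta> z = z" by (simp_all add: LIMSEQ_const_iff)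
  then have "common_fixed_point C T z"
    using common_fixed_point_of_two[OF assms(4) T \<alpha>\<beta> z(1)] by blast
  moreover have "weakly_converges x z"
    using z(3) unfolding weakly_converges_def y_def by (auto intro: LIMSEQ_imp_Suc)
  ultimately show ?thesis by blast
qed

end
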